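(* Let $C$ and $D$ be bifiltered chain complexes over a field $\mathbb{F}$ (each given by a finitely generated chain complex with a value function in $\mathbb{R}^2$), and suppose that $D$ is quasi-isomorphic to $C$, through chain maps $f^p_*:C^p_*\to D^p_*$, $p\in\mathbb{R}^2$. Then for every $p\in\mathbb{R}^2$ and every $k$, $D$ has to add at least $\delta^p_k(C)$ $k$-generators at value $p$, i.e. $$\delta^p_k(C)\le\gamma^p_k(D).$$
   Context: Bifiltered chain complexes. Fix a field $\mathbb{F}$. A (finitely generated) chain complex $C_*=(C_k,\partial_k)_{0\le k\le d}$ consists of the $\mathbb{F}$-vector spaces $C_k$ spanned by given finite sets of $k$-generators, and linear maps $\partial_k:C_k\to C_{k-1}$ with $\partial_{k-1}\partial_k=0$. For a chain $c$ and a generator $g$ of the same dimension, $\langle c,g\rangle\in\mathbb{F}$ is the coefficient of $g$ in $c$. On $\mathbb{R}^2$, $p\le q$ means $p_x\le q_x$ and $p_y\le q_y$, and $q<p$ means $q\le p$ and $q\ne p$. A value function assigns to each generator $g$ a value $v(g)\in\mathbb{R}^2$ such that $\langle\partial_k g,g'\rangle\ne0$ implies $v(g')\le v(g)$; the value $v(c)$ of a chain $c$ is the least common upper bound of the values of the generators in its support. For $p\in\mathbb{R}^2$, $C^p_*$ is the subcomplex of chains of value $\le p$ (the span of the generators $g$ with $v(g)\le p$). The collection $C=(C^p_* )_{p\in\mathbb{R}^2}$ is the bifiltered chain complex; for $p\le q$ one has inclusions $C^p_*\subseteq C^q_*$. Quasi-isomorphism. $C$ and $D$ are quasi-isomorphic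 if there are chain maps $f^p_*:C^p_*\to D^p_*$ for all $p\in\mathbb{R}^2$, commuting for all $p\le q$ with the inclusions $C^p_*\subseteq C^q_*$ and $D^p_*\subseteq D^q_*$, and inducing isomorphisms $H_k(C^p_* )\to H_k(D^p_* )$ for all $p$ and $k$. The quantities $\delta$ and $\gamma$. For a bifiltered chain complex $D$ and $p\in\mathbb{R}^2$, let $D^{<p}_*:=\sum_{q<p}D^q_*$ (the subcomplex spanned by the union of the generators of the summands), and let $\eta^p_k:H_k(D^{<p}_* )\to H_k(D^p_* )$ be the map induced by inclusion. Then $$\delta^p_k(D):=\dim\ker\eta^p_{k-1}+\dim\operatorname{coker}\eta^p_k,\qquad \gamma^p_k(D):=\dim D^p_k-\dim D^{<p}_k,$$ the latter being the number of $k$-generators added at value $p$ in $D$. *)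

theory Defs
  imports "Jordan_Normal_Form.VS_Connect" "HOL-Algebra.QuotRing" "HOL-Library.Product_Order"
begin

text \<open>Scalar multiplication of cosets follows \<^const>\<open>rcoset_mult\<close>. The ring multiplication and the
  unit, which the record \<^typ>\<open>('a, 'b) module\<close> also carries, have no meaning for vector spaces.\<close>

definition quot_space :: "('a, 'b, 'm) module_scheme \<Rightarrow> 'b set \<Rightarrow> ('a, 'b set) module" where
  "quot_space V W =
    \<lparr> carrier = a_rcosets\<^bsub>V\<^esub> W, mult = undefined, one = undefined, zero = W, add = set_add V,
      smult = (\<lambda>a X. \<Union>x\<in>X. W +>\<^bsub>V\<^esub> (a \<odot>\<^bsub>V\<^esub> x)) \<rparr>"

definition homology ::
  "(int \<Rightarrow> ('a, 'b) module) \<Rightarrow> (int \<Rightarrow> 'b \<Rightarrow> 'b) \<Rightarrow> int \<Rightarrow> ('a, 'b set) module" where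
  "homology V d k =
    quot_space ((V k)\<lparr>carrier := mod_hom.ker (V k) (V (k - 1)) (d k)\<rparr>)
      (mod_hom.im (V (k + 1)) (d (k + 1)))"

text \<open>The map into \<^term>\<open>homology W d k\<close> induced by a chain map \<open>h\<close>: the class of a cycle \<open>z\<close> is sent to
  the class of \<open>h k z\<close>.\<close>

definition homology_map ::
  "(int \<Rightarrow> ('a, 'c) module) \<Rightarrow> (int \<Rightarrow> 'c \<Rightarrow> 'c) \<Rightarrow> (int \<Rightarrow> 'b \<Rightarrow> 'c) \<Rightarrow> int \<Rightarrow> 'b set \<Rightarrow> 'c set" where
  "homology_map W d h k X = (\<Union>z\<in>X. mod_hom.im (W (k + 1)) (d (k + 1)) +>\<^bsub>W k\<^esub> h k z)"

text \<open>A chain is represented by its coefficient function. For finite \<open>S\<close> the space below is the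
  vector space with basis \<open>S\<close>.\<close>

definition chain_space :: "'g set \<Rightarrow> ('f::field, 'g \<Rightarrow> 'f) module" where
  "chain_space S =
    \<lparr> carrier = {c. \<forall>g. c g \<noteq> 0 \<longrightarrow> g \<in> S}, mult = undefined, one = undefined,
      zero = (\<lambda>g. 0), add = (\<lambda>c c' g. c g + c' g), smult = (\<lambda>a c g. a * c g) \<rparr>"

definition gen_chain :: "'g \<Rightarrow> 'g \<Rightarrow> 'f::field" where
  "gen_chain g = (\<lambda>g'. if g' = g then 1 else 0)"

text \<open>The degree is an integer and the complex vanishes outside \<open>0, \<dots>, d\<close>, so that degree \<open>0\<close> is not
  exceptional. The order on \<^typ>\<open>real \<times> real\<close> is componentwise. Values may depend on the degree since
  the same element of \<open>'g\<close> may serve as a generator in several degrees.\<close>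

record ('g, 'f) bifiltered_complex =
  gens :: "int \<Rightarrow> 'g set"
  bd :: "int \<Rightarrow> ('g \<Rightarrow> 'f) \<Rightarrow> ('g \<Rightarrow> 'f)"
  val :: "int \<Rightarrow> 'g \<Rightarrow> real \<times> real"

locale bifiltered_chain_complex =
  fixes C :: "('g, 'f::field) bifiltered_complex"
  assumes gens_bounded: "\<exists>d::nat. \<forall>k. k \<notin> {0..int d} \<longrightarrow> gens C k = {}"
    and finite_gens: "finite (gens C k)"
    and bd_linear: "linear_map class_ring (chain_space (gens C k)) (chain_space (gens C (k - 1))) (bd C k)"
    and bd_bd: "c \<in> carrier (chain_space (gens C k)) \<Longrightarrow> bd C (k - 1) (bd C k c) = (\<lambda>g. 0)"
    and val_mono: "g \<in> gens C k \<Longrightarrow> g' \<in> gens C (k - 1) \<Longrightarrow> bd C k (gen_chain g) g' \<noteq> 0 \<Longrightarrow>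
      val C (k - 1) g' \<le> val C k g"

text \<open>The subcomplexes \<open>C\<^sup>p\<close> and \<open>C\<^sup><\<^sup>p\<close>, the latter being spanned by the generators of all \<open>C\<^sup>q\<close> with
  \<open>q < p\<close>. A chain has value at most \<open>p\<close> iff all generators in its support do.\<close>

definition upto_gens ::
  "('g, 'f::field) bifiltered_complex \<Rightarrow> real \<times> real \<Rightarrow> int \<Rightarrow> 'g set" where
  "upto_gens C p k = {g \<in> gens C k. val C k g \<le> p}"

definition upto ::
  "('g, 'f::field) bifiltered_complex \<Rightarrow> real \<times> real \<Rightarrow> int \<Rightarrow> ('f, 'g \<Rightarrow> 'f) module" where
  "upto C p k = chain_space (upto_gens C p k)"

definition below ::
  "('g, 'f::field) bifiltered_complex \<Rightarrow> real \<times> real \<Rightarrow> int \<Rightarrow> ('f, 'g \<Rightarrow> 'f) module" where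
  "below C p k = chain_space (\<Union>q\<in>{q. q < p}. upto_gens C q k)"

abbreviation H_upto ::
  "('g, 'f::field) bifiltered_complex \<Rightarrow> real \<times> real \<Rightarrow> int \<Rightarrow> ('f, ('g \<Rightarrow> 'f) set) module" where
  "H_upto C p k \<equiv> homology (upto C p) (bd C) k"

abbreviation H_below ::
  "('g, 'f::field) bifiltered_complex \<Rightarrow> real \<times> real \<Rightarrow> int \<Rightarrow> ('f, ('g \<Rightarrow> 'f) set) module" where
  "H_below C p k \<equiv> homology (below C p) (bd C) k"

definition quasi_isomorphism ::
  "('g, 'f::field) bifiltered_complex \<Rightarrow> ('h, 'f) bifiltered_complex \<Rightarrow>
    (real \<times> real \<Rightarrow> int \<Rightarrow> ('g \<Rightarrow> 'f) \<Rightarrow> ('h \<Rightarrow> 'f)) \<Rightarrow> bool" where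
  "quasi_isomorphism C D f \<longleftrightarrow>
    (\<forall>p k. linear_map class_ring (upto C p k) (upto D p k) (f p k)) \<and>
    (\<forall>p k. \<forall>c\<in>carrier (upto C p k). f p (k - 1) (bd C k c) = bd D k (f p k c)) \<and>
    (\<forall>p q k. p \<le> q \<longrightarrow> (\<forall>c\<in>carrier (upto C p k). f q k c = f p k c)) \<and>
    (\<forall>p k. linear_map class_ring (H_upto C p k) (H_upto D p k) (homology_map (upto D p) (bd D) (f p) k) \<and>
      bij_betw (homology_map (upto D p) (bd D) (f p) k)
        (carrier (H_upto C p k)) (carrier (H_upto D p k)))"

definition eta ::
  "('g, 'f::field) bifiltered_complex \<Rightarrow> real \<times> real \<Rightarrow> int \<Rightarrow> ('g \<Rightarrow> 'f) set \<Rightarrow> ('g \<Rightarrow> 'f) set" where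
  "eta C p k = homology_map (upto C p) (bd C) (\<lambda>k c. c) k"

definition delta :: "('g, 'f::field) bifiltered_complex \<Rightarrow> real \<times> real \<Rightarrow> int \<Rightarrow> nat" where
  "delta C p k =
    vectorspace.dim class_ring ((H_below C p (k - 1))
      \<lparr>carrier := mod_hom.ker (H_below C p (k - 1)) (H_upto C p (k - 1)) (eta C p (k - 1))\<rparr>) +
    vectorspace.dim class_ring
      (quot_space (H_upto C p k) (mod_hom.im (H_below C p k) (eta C p k)))"

definition gamma :: "('g, 'f::field) bifiltered_complex \<Rightarrow> real \<times> real \<Rightarrow> int \<Rightarrow> int" where
  "gamma C p k =
    int (vectorspace.dim class_ring (upto C p k)) - int (vectorspace.dim class_ring (below C p k))"

end

theory Submission
  imports Defs "HOL-Library.Function_Algebras" "Jordan_Normal_Form.DL_Rank"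
begin

text \<open>Write \<open>A \<subseteq> X\<close> for \<open>C\<^sup><\<^sup>p \<subseteq> C\<^sup>p\<close> and \<open>E \<subseteq> Y\<close> for \<open>D\<^sup><\<^sup>p \<subseteq> D\<^sup>p\<close>. The long exact sequence of
  the pair \<open>(X, A)\<close> says that the number \<open>\<delta>\<close> of \<open>C\<close> at \<open>p\<close> is the dimension of the relative homology
  \<open>H\<^sub>k(X, A)\<close>. A quasi-isomorphism makes \<open>H\<^sub>k(X, A)\<close> a subspace of \<open>H\<^sub>k(Y, E)\<close>, which is a subquotient of
  the chain space \<open>Y\<^sub>k / E\<^sub>k\<close>, and the dimension of the latter is the number \<open>\<gamma>\<close> of \<open>D\<close> at \<open>p\<close>.

  Relative homology enters only through two subspaces of \<open>X\<^sub>k\<close>: the relative cycles, the chains with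
  boundary in \<open>A\<close>, and the relative boundaries \<open>A\<^sub>k + \<partial>X\<^sub>k\<^sub>+\<^sub>1\<close>. That \<open>\<delta>\<close> is the difference of their
  dimensions (\<open>dim_relative_homology\<close>) is rank-nullity, applied to the boundary map on each of them and to
  the projections to the kernel and the cokernel of \<open>\<eta>\<close>. The bound by \<open>\<gamma>\<close> (\<open>relative_dim_bound\<close>) is
  rank-nullity for the map from relative cycles to \<open>Y\<^sub>k\<close> modulo relative boundaries.

  For that bound, a relative cycle that is mapped to a relative boundary has to be a relative boundary
  itself (\<open>relative_injective\<close>). This needs that the chain map is a quasi-isomorphism not only
  \<open>X \<rightarrow> Y\<close>, which is assumed, but also \<open>A \<rightarrow> E\<close>, although \<open>A\<close> and \<open>E\<close> are not of the form \<open>C\<^sup>q\<close> and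
  \<open>D\<^sup>q\<close>. As there are finitely many generators, there are \<open>q\<^sub>1\<close> and \<open>q\<^sub>2\<close>, slightly to the left of \<open>p\<close> and
  slightly below \<open>p\<close>, such that \<open>A\<close> is the sum of the subcomplexes of \<open>C\<close> at \<open>q\<^sub>1\<close> and \<open>q\<^sub>2\<close>, which
  intersect in the subcomplex at the infimum of \<open>q\<^sub>1\<close> and \<open>q\<^sub>2\<close>; and likewise for \<open>E\<close>. So the
  Mayer-Vietoris argument applies. It is carried out for the mapping cone (\<open>cone_exact_union\<close>): the chain
  map is a quasi-isomorphism if and only if its cone is exact in all degrees, and exactness of the cone is
  a statement about pairs of chains which passes from the two summands and their intersection to the sum by a short
  diagram chase.\<close>

section \<open>Linear maps, subspaces and quotient spaces\<close>

lemma linear_mapI: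
  assumes "vectorspace K V" "vectorspace K W"
    and "\<And>v. v \<in> carrier V \<Longrightarrow> T v \<in> carrier W"
    and "\<And>u v. u \<in> carrier V \<Longrightarrow> v \<in> carrier V \<Longrightarrow> T (u \<oplus>\<^bsub>V\<^esub> v) = T u \<oplus>\<^bsub>W\<^esub> T v"
    and "\<And>a v. a \<in> carrier K \<Longrightarrow> v \<in> carrier V \<Longrightarrow> T (a \<odot>\<^bsub>V\<^esub> v) = a \<odot>\<^bsub>W\<^esub> T v"
  shows "linear_map K V W T"
  using assms
  unfolding linear_map_def mod_hom_def mod_hom_axioms_def LinearCombinations.module_hom_def vectorspace_def
  by auto

lemma linear_map_comp:
  assumes "linear_map K U V S" "linear_map K V W T"
  shows "linear_map K U W (\<lambda>u. T (S u))"
proof -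
  interpret S: linear_map K U V S by fact
  interpret T: linear_map K V W T by fact
  show ?thesis
    by (intro linear_mapI S.V.vectorspace_axioms T.W.vectorspace_axioms) auto
qed

lemma linear_map_restrict:
  assumes "linear_map K V W T" "subspace K U V"
  shows "linear_map K (V\<lparr>carrier := U\<rparr>) W T"
proof -
  interpret T: linear_map K V W T by fact
  have U: "U \<subseteq> carrier V" using assms(2) by (simp add: subspace_def submodule_def)
  show ?thesis
    by (intro linear_mapI T.V.subspace_is_vs assms(2) T.W.vectorspace_axioms)
      (use U in \<open>auto intro!: T.f_add T.f_smult T.f_im\<close>)
qed

lemma linear_map_into_subspace:
  assumes "linear_map K V W T" "subspace K U W" "T ` carrier V \<subseteq> U"
  shows "linear_map K V (W\<lparr>carrier := U\<rparr>) T"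
proof -
  interpret T: linear_map K V W T by fact
  show ?thesis
    by (intro linear_mapI T.W.subspace_is_vs assms(2) T.V.vectorspace_axioms) (use assms(3) in auto)
qed

lemma subspace_image:
  assumes "linear_map K V W T" "subspace K U V"
  shows "subspace K (T ` U) W"
proof -
  interpret T: linear_map K "V\<lparr>carrier := U\<rparr>" W T by (rule linear_map_restrict[OF assms])
  show ?thesis using T.imT_is_subspace by (simp add: T.im_def)
qed

text \<open>The vector space axioms are equations, apart from the existence of negatives, and so pass to \<open>Q\<close>
  along a surjection that respects the operations. Hence this lemma yields at once
  that a quotient is a vector space and that the projection to it is linear.\<close>

lemma linear_map_onto:
  assumes V: "vectorspace K V" and onto: "T ` carrier V = carrier Q"
    and add: "\<And>u v. u \<in> carrier V \<Longrightarrow> v \<in> carrier V \<Longrightarrow> T (u \<oplus>\<^bsub>V\<^esub> v) = T u \<oplus>\<^bsub>Q\<^esub> T v"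
    and smult: "\<And>a v. a \<in> carrier K \<Longrightarrow> v \<in> carrier V \<Longrightarrow> T (a \<odot>\<^bsub>V\<^esub> v) = a \<odot>\<^bsub>Q\<^esub> T v"
    and zero: "T \<zero>\<^bsub>V\<^esub> = \<zero>\<^bsub>Q\<^esub>"
  shows "linear_map K V Q T"
proof -
  interpret V: vectorspace K V by fact
  have im: "T v \<in> carrier Q" if "v \<in> carrier V" for v using that onto by blast
  have all: "P q" if "q \<in> carrier Q" "\<And>v. v \<in> carrier V \<Longrightarrow> P (T v)" for P q
    using that unfolding onto[symmetric] by blast
  note flip = add[symmetric] smult[symmetric]
  have "vectorspace K Q"
  proof (rule vs_criteria, goal_cases)
    case 1 show ?case by unfold_locales
  next
    case 2 show ?case using im[OF V.M.zero_closed] zero by simp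
  next
    case 3 show ?case
      by (intro allI impI, elim conjE, erule all, erule all) (simp only: flip im V.M.add.m_closed)
  next
    case 4 show ?case
    proof
      fix q assume "q \<in> carrier Q"
      then obtain v where v: "v \<in> carrier V" "q = T v" using onto by blast
      then have "q \<oplus>\<^bsub>Q\<^esub> T (\<ominus>\<^bsub>V\<^esub> v) = \<zero>\<^bsub>Q\<^esub>"
        using add[of v "\<ominus>\<^bsub>V\<^esub> v"] zero by (simp add: V.M.r_neg)
      then show "\<exists>neg_v\<in>carrier Q. q \<oplus>\<^bsub>Q\<^esub> neg_v = \<zero>\<^bsub>Q\<^esub>" using im v by blast
    qed
  next
    case 5 show ?case
      by (intro allI impI, elim conjE, erule all) (simp only: flip im V.smult_closed)
  next
    case 6 show ?case
      by (intro allI impI, elim conjE, erule all, erule all) (simp only: flip V.M.a_comm)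
  next
    case 7 show ?case
      by (intro allI impI, elim conjE, erule all, erule all, erule all)
        (simp only: flip V.M.add.m_closed V.M.a_assoc)
  next
    case 8 show ?case
      by (intro ballI, erule all) (simp only: zero[symmetric] flip V.M.zero_closed V.M.r_zero)
  next
    case 9 show ?case
      by (intro allI impI, elim conjE, erule all)
        (simp only: flip V.smult_closed V.R.m_closed V.smult_assoc1)
  next
    case 10 show ?case
      by (intro ballI, erule all) (simp only: flip V.R.one_closed V.smult_one)
  next
    case 11 show ?case
      by (intro allI impI, elim conjE, erule all)
        (simp only: flip V.smult_closed V.R.add.m_closed V.smult_l_distr)
  next
    case 12 show ?case
      by (intro allI impI, elim conjE, erule all, erule all)
        (simp only: flip V.smult_closed V.M.add.m_closed V.smult_r_distr)
  qed
  then show ?thesis by (intro linear_mapI V add smult im)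
qed

text \<open>A map out of a quotient is linear as soon as its composition with the projection is.\<close>

lemma linear_map_factor:
  assumes \<pi>: "linear_map K V Q \<pi>" and onto: "\<pi> ` carrier V = carrier Q"
    and \<phi>: "linear_map K V W \<phi>" and fac: "\<And>v. v \<in> carrier V \<Longrightarrow> \<psi> (\<pi> v) = \<phi> v"
  shows "linear_map K Q W \<psi>"
proof -
  interpret \<pi>: linear_map K V Q \<pi> by fact
  interpret \<phi>: linear_map K V W \<phi> by fact
  have rep: "\<exists>v\<in>carrier V. q = \<pi> v" if "q \<in> carrier Q" for q
    using that unfolding onto[symmetric] by (rule imageE) (rule bexI)
  show ?thesis
  proof (intro linear_mapI \<pi>.W.vectorspace_axioms \<phi>.W.vectorspace_axioms)
    fix q assume "q \<in> carrier Q"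
    then obtain v where "v \<in> carrier V" "q = \<pi> v" by (elim bexE[OF rep])
    then show "\<psi> q \<in> carrier W" using \<phi>.f_im[of v] by (simp add: fac)
  next
    fix q r assume "q \<in> carrier Q" "r \<in> carrier Q"
    then obtain u v where *: "u \<in> carrier V" "v \<in> carrier V" and qr: "q = \<pi> u" "r = \<pi> v"
      by (elim bexE[OF rep])
    show "\<psi> (q \<oplus>\<^bsub>Q\<^esub> r) = \<psi> q \<oplus>\<^bsub>W\<^esub> \<psi> r"
      unfolding qr \<pi>.f_add[OF *, symmetric] fac[OF *(1)] fac[OF *(2)]
        fac[OF \<pi>.V.module.M.add.m_closed[OF *]] by (rule \<phi>.f_add[OF *])
  next
    fix a q assume a: "a \<in> carrier K" and "q \<in> carrier Q"
    then obtain v where *: "v \<in> carrier V" and q: "q = \<pi> v" by (elim bexE[OF rep])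
    show "\<psi> (a \<odot>\<^bsub>Q\<^esub> q) = a \<odot>\<^bsub>W\<^esub> \<psi> q"
      unfolding q \<pi>.f_smult[OF a *, symmetric] fac[OF *] fac[OF \<pi>.V.module.smult_closed[OF a *]]
      by (rule \<phi>.f_smult[OF a *])
  qed
qed

text \<open>A maximal independent subset exists since independent sets of the subspace are independent in the
  whole space and therefore of bounded size; it is a basis of the subspace.\<close>

lemma (in vectorspace) fin_dim_subspace:
  assumes "fin_dim" "subspace K X V"
  shows "vectorspace.fin_dim K (vs X)"
proof -
  interpret X: vectorspace K "vs X" by (rule subspace_is_vs[OF assms(2)])
  have sub: "submodule K X V" using assms(2) by simp
  then have XV: "X \<subseteq> carrier V" by (simp add: submodule_def)
  define P where "P = (\<lambda>S. S \<subseteq> carrier (vs X) \<and> X.lin_indpt S)"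
  have "\<exists>A. finite A \<and> maximal A P"
  proof (rule maximal_exists)
    fix A assume "P A"
    then have "A \<subseteq> X" "lin_indpt A" using span_li_not_depend(2)[OF _ sub] by (auto simp: P_def)
    then show "finite A \<and> card A \<le> dim"
      using li_le_dim[OF assms(1), of A] subset_trans[OF _ XV, of A] by simp
  next
    show "P {}" by (auto simp: P_def X.lin_dep_def)
  qed
  then obtain A where "finite A" "maximal A P" by blast
  then have "X.basis A" using X.max_li_is_basis unfolding P_def by blast
  then show ?thesis using \<open>finite A\<close> unfolding X.fin_dim_def X.basis_def by blast
qed

lemma (in vectorspace) subspace_dim_mono:
  assumes "fin_dim" "subspace K X V" "subspace K Y V" "X \<subseteq> Y"
  shows "vectorspace.dim K (vs X) \<le> vectorspace.dim K (vs Y)"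
proof -
  interpret Y: vectorspace K "vs Y" by (rule subspace_is_vs[OF assms(3)])
  have "subspace K X (vs Y)" by (rule nested_subspaces[OF assms(3,2,4)])
  then show ?thesis
    using Y.subspace_dim fin_dim_subspace[OF assms(1)] assms by simp
qed

lemma (in vectorspace) abelian_subgroup_subspace:
  assumes "subspace K W V"
  shows "abelian_subgroup W V"
proof -
  have "submodule K W V" using assms by simp
  then have W: "W \<subseteq> carrier V" "\<zero>\<^bsub>V\<^esub> \<in> W" "\<And>v w. v \<in> W \<Longrightarrow> w \<in> W \<Longrightarrow> v \<oplus>\<^bsub>V\<^esub> w \<in> W"
    "\<And>c v. c \<in> carrier K \<Longrightarrow> v \<in> W \<Longrightarrow> c \<odot>\<^bsub>V\<^esub> v \<in> W"
    by (auto simp: submodule_def)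
  have neg: "\<ominus>\<^bsub>V\<^esub> v \<in> W" if "v \<in> W" for v
    using W(4)[of "\<ominus>\<^bsub>K\<^esub> \<one>\<^bsub>K\<^esub>" v] that W(1) by (auto simp: smult_minus_1)
  have "subgroup W (add_monoid V)"
    using W neg by (intro group.subgroupI M.a_group) (auto simp: a_inv_def)
  then show ?thesis
    by (intro abelian_subgroupI3 additive_subgroup.intro M.abelian_group_axioms)
qed

lemma (in vectorspace) quot_space_projection:
  assumes "subspace K W V"
  shows "linear_map K V (quot_space V W) (\<lambda>v. W +>\<^bsub>V\<^esub> v)" (is ?lin)
    and "(\<lambda>v. W +>\<^bsub>V\<^esub> v) ` carrier V = carrier (quot_space V W)" (is ?onto)
    and "v \<in> carrier V \<Longrightarrow> W +>\<^bsub>V\<^esub> v = \<zero>\<^bsub>quot_space V W\<^esub> \<longleftrightarrow> v \<in> W" (is "_ \<Longrightarrow> ?ker")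
proof -
  interpret W: abelian_subgroup W V by (rule abelian_subgroup_subspace[OF assms])
  have sub: "submodule K W V" using assms by simp
  then have W: "W \<subseteq> carrier V" "\<And>c v. c \<in> carrier K \<Longrightarrow> v \<in> W \<Longrightarrow> c \<odot>\<^bsub>V\<^esub> v \<in> W"
    by (auto simp: submodule_def)
  show onto: ?onto by (auto simp: quot_space_def A_RCOSETS_def')
  have smult: "(\<Union>x\<in>W +>\<^bsub>V\<^esub> v. W +>\<^bsub>V\<^esub> a \<odot>\<^bsub>V\<^esub> x) = W +>\<^bsub>V\<^esub> a \<odot>\<^bsub>V\<^esub> v"
    if av: "a \<in> carrier K" "v \<in> carrier V" for a v
  proof -
    have "W +>\<^bsub>V\<^esub> a \<odot>\<^bsub>V\<^esub> x = W +>\<^bsub>V\<^esub> a \<odot>\<^bsub>V\<^esub> v" if x: "x \<in> W +>\<^bsub>V\<^esub> v" for x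
    proof -
      obtain w where w: "w \<in> W" "x = w \<oplus>\<^bsub>V\<^esub> v" using x by (auto simp: a_r_coset_def')
      then have "a \<odot>\<^bsub>V\<^esub> x = a \<odot>\<^bsub>V\<^esub> w \<oplus>\<^bsub>V\<^esub> a \<odot>\<^bsub>V\<^esub> v"
        using smult_r_distr[OF av(1) subsetD[OF W(1) w(1)] av(2)] by simp
      then have "a \<odot>\<^bsub>V\<^esub> x \<in> W +>\<^bsub>V\<^esub> a \<odot>\<^bsub>V\<^esub> v"
        using W(2)[OF av(1) w(1)] by (auto simp: a_r_coset_def')
      then show ?thesis
        using M.a_repr_independence[OF _ smult_closed[OF av] W.a_subgroup] by simp
    qed
    moreover have "v \<in> W +>\<^bsub>V\<^esub> v" using av W.a_rcos_self by blast
    ultimately show ?thesis by blast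
  qed
  show ?lin
  proof (rule linear_map_onto[OF vectorspace_axioms onto])
    show "W +>\<^bsub>V\<^esub> \<zero>\<^bsub>V\<^esub> = \<zero>\<^bsub>quot_space V W\<^esub>"
      using W by (simp add: quot_space_def M.a_coset_add_zero)
  next
    show "W +>\<^bsub>V\<^esub> (u \<oplus>\<^bsub>V\<^esub> v) = (W +>\<^bsub>V\<^esub> u) \<oplus>\<^bsub>quot_space V W\<^esub> (W +>\<^bsub>V\<^esub> v)"
      if "u \<in> carrier V" "v \<in> carrier V" for u v
      using that by (simp add: quot_space_def W.a_rcos_sum)
  next
    show "W +>\<^bsub>V\<^esub> (a \<odot>\<^bsub>V\<^esub> v) = a \<odot>\<^bsub>quot_space V W\<^esub> (W +>\<^bsub>V\<^esub> v)"
      if "a \<in> carrier K" "v \<in> carrier V" for a v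
      using that by (simp add: quot_space_def smult)
  qed
  show ?ker if "v \<in> carrier V"
  proof -
    have "W +>\<^bsub>V\<^esub> v = W \<longleftrightarrow> v \<in> W"
    proof
      assume "W +>\<^bsub>V\<^esub> v = W"
      then show "v \<in> W" by (rule M.a_coset_join1[OF _ that W.a_subgroup])
    next
      assume "v \<in> W"
      then show "W +>\<^bsub>V\<^esub> v = W" by (rule M.a_coset_join2[OF that W.a_subgroup])
    qed
    then show ?thesis by (simp add: quot_space_def)
  qed
qed

lemma (in vectorspace) dim_quot_space:
  assumes "fin_dim" "subspace K W V"
  shows "vectorspace.dim K (quot_space V W) + vectorspace.dim K (vs W) = dim"
    and "vectorspace.fin_dim K (quot_space V W)"
proof -
  note \<pi> = quot_space_projection[OF assms(2)]
  have W: "W \<subseteq> carrier V" using assms(2) by (simp add: subspace_def submodule_def)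
  have hom: "mod_hom K V (quot_space V W) (\<lambda>v. W +>\<^bsub>V\<^esub> v)"
    using \<pi>(1) by (simp only: linear_map_def)
  have "mod_hom.ker V (quot_space V W) (\<lambda>v. W +>\<^bsub>V\<^esub> v) = W"
    unfolding mod_hom.ker_def[OF hom] using W \<pi>(3) by blast
  moreover have "mod_hom.im V (\<lambda>v. W +>\<^bsub>V\<^esub> v) = carrier (quot_space V W)"
    unfolding mod_hom.im_def[OF hom] by (rule \<pi>(2))
  ultimately show "vectorspace.dim K (quot_space V W) + vectorspace.dim K (vs W) = dim"
    using linear_map.rank_nullity_main(1)[OF \<pi>(1) assms(1)] by simp
  show "vectorspace.fin_dim K (quot_space V W)"
    by (rule linear_map.rank_nullity_main(2)[OF \<pi>(1) assms(1) \<pi>(2)])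
qed

section \<open>Spaces of chains\<close>

abbreviation chains :: "'g set \<Rightarrow> ('g \<Rightarrow> 'f::field) set" where
  "chains S \<equiv> carrier (chain_space S)"

lemma chains_iff: "c \<in> chains S \<longleftrightarrow> (\<forall>g. g \<notin> S \<longrightarrow> c g = 0)"
  by (auto simp: chain_space_def)

text \<open>Together with the pointwise operations \<open>0\<close>, \<open>+\<close> and \<open>-\<close> on functions, \<open>scale\<close> makes the algebra of
  chains independent of the set of generators.\<close>

definition scale :: "'f::field \<Rightarrow> ('g \<Rightarrow> 'f) \<Rightarrow> ('g \<Rightarrow> 'f)" where
  "scale a c = (\<lambda>g. a * c g)"

lemma scale_minus_one [simp]: "scale (-1) c = - c"
  by (simp add: scale_def fun_eq_iff)

lemma chain_space_simps [simp]:
  "zero (chain_space S) = 0" "add (chain_space S) = (+)" "smult (chain_space S) = scale"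
  by (simp_all add: chain_space_def fun_eq_iff scale_def)

lemma vectorspace_chain_space:
  fixes S :: "'g set"
  shows "vectorspace class_ring (chain_space S :: ('f::field, 'g \<Rightarrow> 'f) module)"
proof (rule vs_criteria, goal_cases)
  case 1 show ?case by (rule class_field.field_axioms)
next
  case 4
  have "v + - v = 0" "- v \<in> chains S" if "v \<in> chains S" for v :: "'g \<Rightarrow> 'f"
    using that by (auto simp: chains_iff)
  then show ?case unfolding chain_space_simps by blast
qed (auto simp: chains_iff scale_def fun_eq_iff algebra_simps)

text \<open>The operations of a chain space do not depend on its generators, so that subspaces of all chain spaces
  over the same type can be treated as subspaces of the space of all functions.\<close>

definition chain_subspace :: "('g \<Rightarrow> 'f::field) set \<Rightarrow> ('f, 'g \<Rightarrow> 'f) module" where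
  "chain_subspace U = (chain_space UNIV)\<lparr>carrier := U\<rparr>"

lemma chain_subspace_simps [simp]:
  "zero (chain_subspace U) = 0" "add (chain_subspace U) = (+)" "smult (chain_subspace U) = scale"
  "carrier (chain_subspace U) = U" "(chain_subspace U)\<lparr>carrier := W\<rparr> = chain_subspace W"
  "(chain_space S)\<lparr>carrier := U\<rparr> = chain_subspace U"
  by (simp_all add: chain_subspace_def) (simp add: chain_space_def)

lemma chain_subspace_chains: "chain_subspace (chains S) = chain_space S"
  by (simp add: chain_subspace_def chain_space_def)

lemma subspace_iff:
  fixes U :: "('g \<Rightarrow> 'f::field) set"
  shows "subspace class_ring U (chain_space S) \<longleftrightarrow> U \<subseteq> chains S \<and> 0 \<in> U \<and>
     (\<forall>u\<in>U. \<forall>v\<in>U. u + v \<in> U) \<and> (\<forall>a. \<forall>u\<in>U. scale a u \<in> U)"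
proof -
  have V: "vectorspace class_ring (chain_space S :: ('f, 'g \<Rightarrow> 'f) module)"
    by (rule vectorspace_chain_space)
  then have M: "module class_ring (chain_space S :: ('f, 'g \<Rightarrow> 'f) module)"
    by (simp only: vectorspace_def)
  show ?thesis
    unfolding subspace_def submodule_def chain_space_simps using V M by (simp only: simp_thms) auto
qed

lemma chains_mono: "S \<subseteq> T \<Longrightarrow> chains S \<subseteq> chains T"
  unfolding subset_iff chains_iff by blast

lemma subspace_chains: "S \<subseteq> T \<Longrightarrow> subspace class_ring (chains S :: ('g \<Rightarrow> 'f::field) set) (chain_space T)"
  using chains_mono[of S T] by (auto simp: subspace_iff chains_iff scale_def)

text \<open>Generators span: a property of chains that defines a subspace need only be checked on generators.\<close>

lemma chains_subset_subspace:
  fixes U :: "('g \<Rightarrow> 'f::field) set"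
  assumes "finite S" "subspace class_ring U (chain_space T)" "\<And>g. g \<in> S \<Longrightarrow> gen_chain g \<in> U"
  shows "chains S \<subseteq> U"
  using assms(1,3)
proof (induction S rule: finite_induct)
  case empty
  have "c = 0" if "c \<in> chains {}" for c :: "'g \<Rightarrow> 'f"
    using that by (simp add: chains_iff fun_eq_iff)
  then show ?case using assms(2) by (auto simp: subspace_iff)
next
  case (insert g S)
  show ?case
  proof
    fix c :: "'g \<Rightarrow> 'f" assume c: "c \<in> chains (insert g S)"
    have eq: "c = c(g := 0) + scale (c g) (gen_chain g)"
      by (auto simp: scale_def gen_chain_def fun_eq_iff)
    have "c(g := 0) \<in> chains S" using c by (auto simp: chains_iff)
    then have "c(g := 0) \<in> U" using insert by blast
    moreover have "scale (c g) (gen_chain g) \<in> U"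
      using assms(2) insert.prems[of g] by (simp add: subspace_iff)
    ultimately have "c(g := 0) + scale (c g) (gen_chain g) \<in> U" using assms(2) by (simp add: subspace_iff)
    then show "c \<in> U" by (simp only: eq[symmetric])
  qed
qed

lemma fin_dim_chain_space:
  assumes "finite S"
  shows "vectorspace.fin_dim class_ring (chain_space S :: ('f::field, 'g \<Rightarrow> 'f) module)"
proof -
  interpret vectorspace class_ring "chain_space S :: ('f, 'g \<Rightarrow> 'f) module"
    by (rule vectorspace_chain_space)
  let ?G = "gen_chain ` S :: ('g \<Rightarrow> 'f) set"
  have G: "?G \<subseteq> chains S" by (auto simp: chains_iff gen_chain_def)
  have "chains S \<subseteq> span ?G"
    by (rule chains_subset_subspace[OF assms span_is_subspace[OF G]])
      (use in_own_span[OF G] in blast)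
  moreover have "span ?G \<subseteq> chains S" using span_is_subset2[OF G] by simp
  ultimately show ?thesis unfolding fin_dim_def using assms G by blast
qed

definition subdim :: "('g \<Rightarrow> 'f::field) set \<Rightarrow> nat" where
  "subdim U = vectorspace.dim class_ring (chain_subspace U)"

abbreviation subsp :: "('g \<Rightarrow> 'f::field) set \<Rightarrow> bool" where
  "subsp U \<equiv> subspace class_ring U (chain_space UNIV)"

lemma chains_UNIV [simp]: "chains UNIV = UNIV"
  by (simp add: chain_space_def)

lemma subsp_iff:
  "subsp U \<longleftrightarrow> 0 \<in> U \<and> (\<forall>u\<in>U. \<forall>v\<in>U. u + v \<in> U) \<and> (\<forall>a. \<forall>u\<in>U. scale a u \<in> U)"
  by (simp add: subspace_iff subset_iff)

lemma subspD:
  assumes "subsp U"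
  shows "0 \<in> U" "u \<in> U \<Longrightarrow> v \<in> U \<Longrightarrow> u + v \<in> U" "u \<in> U \<Longrightarrow> scale a u \<in> U"
  using assms unfolding subsp_iff by blast+

lemma subsp_diff:
  assumes "subsp U" "u \<in> U" "v \<in> U"
  shows "u - v \<in> U"
proof -
  have "scale (-1) v \<in> U" using assms(1,3) unfolding subsp_iff by blast
  then have "- v \<in> U" by (simp only: scale_minus_one)
  then have "u + - v \<in> U" using assms(1,2) unfolding subsp_iff by blast
  then show ?thesis by simp
qed

lemma vectorspace_chain_subspace: "subsp U \<Longrightarrow> vectorspace class_ring (chain_subspace U)"
  unfolding chain_subspace_def by (rule vectorspace.subspace_is_vs[OF vectorspace_chain_space])

lemma subspace_chain_subspace:
  assumes "subsp U" "subsp W" "W \<subseteq> U"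
  shows "subspace class_ring W (chain_subspace U)"
  using vectorspace.nested_subspaces[OF vectorspace_chain_space assms] by simp

lemma fin_dim_chain_subspace:
  assumes "finite S" "subsp U" "U \<subseteq> chains S"
  shows "vectorspace.fin_dim class_ring (chain_subspace U)"
proof -
  have "subspace class_ring U (chain_space S)"
    using assms by (simp add: subspace_iff subsp_iff)
  from vectorspace.fin_dim_subspace[OF vectorspace_chain_space fin_dim_chain_space[OF assms(1)] this]
  show ?thesis by simp
qed

lemma subdim_mono:
  assumes "finite S" "subsp U" "subsp W" "U \<subseteq> W" "W \<subseteq> chains S"
  shows "subdim U \<le> subdim W"
proof -
  have "subspace class_ring U (chain_space S)" "subspace class_ring W (chain_space S)"
    using assms by (auto simp: subspace_iff subsp_iff)
  from vectorspace.subspace_dim_mono[OF vectorspace_chain_space fin_dim_chain_space[OF assms(1)] this assms(4)]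
  show ?thesis by (simp add: subdim_def)
qed

lemma rank_nullity_subdim:
  assumes "finite S" "subsp U" "U \<subseteq> chains S" and \<phi>: "linear_map class_ring (chain_subspace U) Q \<phi>"
  shows "vectorspace.dim class_ring (Q\<lparr>carrier := \<phi> ` U\<rparr>) + subdim {u \<in> U. \<phi> u = \<zero>\<^bsub>Q\<^esub>} = subdim U"
proof -
  have hom: "mod_hom class_ring (chain_subspace U) Q \<phi>"
    using \<phi> by (simp only: linear_map_def)
  show ?thesis
    using linear_map.rank_nullity[OF \<phi> fin_dim_chain_subspace[OF assms(1-3)]]
    by (simp add: mod_hom.im_def[OF hom] mod_hom.ker_def[OF hom] subdim_def)
qed

text \<open>The value of \<^const>\<open>a_r_coset\<close> in every chain space and in all of its subspaces.\<close>

definition coset :: "('g \<Rightarrow> 'f::field) set \<Rightarrow> ('g \<Rightarrow> 'f) \<Rightarrow> ('g \<Rightarrow> 'f) set" where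
  "coset B z = (\<lambda>b. b + z) ` B"

lemma a_r_coset_chain [simp]:
  "a_r_coset (chain_space S) B z = coset B z" "a_r_coset (chain_subspace U) B z = coset B z"
  by (auto simp: a_r_coset_def' coset_def)

lemma coset_eqI:
  assumes "subsp B" "z - w \<in> B"
  shows "coset B z = coset B w"
proof -
  have "b + z \<in> coset B w" if "b \<in> B" for b
  proof -
    have "b + (z - w) \<in> B" using assms that by (simp add: subsp_iff)
    moreover have "b + z = (b + (z - w)) + w" by simp
    ultimately show ?thesis unfolding coset_def by (intro image_eqI)
  qed
  moreover have "b + w \<in> coset B z" if "b \<in> B" for b
  proof -
    have "b - (z - w) \<in> B" using subsp_diff[OF assms(1) that assms(2)] .
    moreover have "b + w = (b - (z - w)) + z" by simp
    ultimately show ?thesis unfolding coset_def by (intro image_eqI)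
  qed
  ultimately show ?thesis unfolding coset_def by blast
qed

lemma coset_eq_iff:
  assumes "subsp B"
  shows "coset B z = coset B w \<longleftrightarrow> z - w \<in> B"
proof
  assume "coset B z = coset B w"
  moreover have "z \<in> coset B z"
    unfolding coset_def using assms by (intro image_eqI[of _ _ 0]) (simp_all add: subsp_iff)
  ultimately obtain b where "b \<in> B" "z = b + w" by (auto simp: coset_def)
  then show "z - w \<in> B" by simp
qed (rule coset_eqI[OF assms])

lemma linear_map_chains:
  assumes "linear_map class_ring (chain_space S) (chain_space T) h"
  shows "c \<in> chains S \<Longrightarrow> h c \<in> chains T"
    and "c \<in> chains S \<Longrightarrow> e \<in> chains S \<Longrightarrow> h (c + e) = h c + h e"
    and "c \<in> chains S \<Longrightarrow> h (scale a c) = scale a (h c)"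
    and "h 0 = 0"
    and "c \<in> chains S \<Longrightarrow> e \<in> chains S \<Longrightarrow> h (c - e) = h c - h e"
proof -
  have hom: "mod_hom class_ring (chain_space S) (chain_space T) h"
    using assms by (simp only: linear_map_def)
  then have h: "h \<in> LinearCombinations.module_hom class_ring (chain_space S) (chain_space T)"
    by (rule mod_hom.f_hom)
  show "c \<in> chains S \<Longrightarrow> h c \<in> chains T" for c by (rule mod_hom.f_im[OF hom])
  show add: "c \<in> chains S \<Longrightarrow> e \<in> chains S \<Longrightarrow> h (c + e) = h c + h e" for c e
    using LinearCombinations.module_hom_add[OF h] by simp
  show smult: "c \<in> chains S \<Longrightarrow> h (scale a c) = scale a (h c)" for a c
    using LinearCombinations.module_hom_smult[OF h] by simp
  show "h 0 = 0" using mod_hom.f0_is_0[OF hom] by simp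
  assume "c \<in> chains S" and e: "e \<in> chains S"
  moreover have "- e \<in> chains S" using e by (simp add: chains_iff)
  ultimately show "h (c - e) = h c - h e"
    using add[of c "- e"] smult[of e "-1"] by simp
qed

lemma subsp_chains [simp]: "subsp (chains S)"
  by (rule subspace_chains) simp

lemma linear_map_on_subsp:
  assumes "linear_map class_ring (chain_space S) W h" "subsp U" "U \<subseteq> chains S"
  shows "linear_map class_ring (chain_subspace U) W h"
proof -
  have "subspace class_ring U (chain_space S)" using assms by (simp add: subspace_iff subsp_iff)
  from linear_map_restrict[OF assms(1) this] show ?thesis by simp
qed

section \<open>Complexes of chains and their homology\<close>

locale free_complex =
  fixes S :: "int \<Rightarrow> 'g set" and d :: "int \<Rightarrow> ('g \<Rightarrow> 'f::field) \<Rightarrow> ('g \<Rightarrow> 'f)"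
  assumes d_linear: "linear_map class_ring (chain_space (S k)) (chain_space (S (k - 1))) (d k)"
    and d_d: "c \<in> chains (S k) \<Longrightarrow> d (k - 1) (d k c) = 0"

context free_complex
begin

definition cycles :: "int \<Rightarrow> ('g \<Rightarrow> 'f) set" where
  "cycles k = {c \<in> chains (S k). d k c = 0}"

definition boundaries :: "int \<Rightarrow> ('g \<Rightarrow> 'f) set" where
  "boundaries k = d (k + 1) ` chains (S (k + 1))"

abbreviation H :: "int \<Rightarrow> ('f, ('g \<Rightarrow> 'f) set) module" where
  "H k \<equiv> homology (\<lambda>k. chain_space (S k)) d k"

lemmas d_closed = linear_map_chains(1)[OF d_linear]
  and d_add = linear_map_chains(2)[OF d_linear]
  and d_scale = linear_map_chains(3)[OF d_linear]
  and d_zero = linear_map_chains(4)[OF d_linear]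
  and d_diff = linear_map_chains(5)[OF d_linear]

lemma d_hom: "mod_hom class_ring (chain_space (S k)) (chain_space (S (k - 1))) (d k)"
  using d_linear[of k] by (simp only: linear_map_def)

lemma d_linear_into: "linear_map class_ring (chain_space (S (k + 1))) (chain_space (S k)) (d (k + 1))"
  using d_linear[of "k + 1"] by simp

lemma im_d: "mod_hom.im (chain_space (S (k + 1))) (d (k + 1)) = boundaries k"
  using mod_hom.im_def[OF d_hom, of "k + 1"] by (simp add: boundaries_def)

lemma ker_d: "mod_hom.ker (chain_space (S k)) (chain_space (S (k - 1))) (d k) = cycles k"
  using mod_hom.ker_def[OF d_hom, of k] by (simp add: cycles_def)

lemma H_eq: "H k = quot_space (chain_subspace (cycles k)) (boundaries k)"
  by (simp add: homology_def im_d ker_d)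

lemma boundaries_subset_cycles: "boundaries k \<subseteq> cycles k"
proof
  fix b assume "b \<in> boundaries k"
  then obtain c where "c \<in> chains (S (k + 1))" "b = d (k + 1) c" by (auto simp: boundaries_def)
  then show "b \<in> cycles k"
    using d_d[of c "k + 1"] d_closed[of c "k + 1"] by (simp add: cycles_def)
qed

lemma cycles_subset: "cycles k \<subseteq> chains (S k)"
  by (auto simp: cycles_def)

lemma boundaries_subset: "boundaries k \<subseteq> chains (S k)"
  using boundaries_subset_cycles cycles_subset by blast

lemma subsp_cycles [simp]: "subsp (cycles k)"
  using subsp_chains[of "S k"] d_zero[of k]
  by (auto simp: subsp_iff cycles_def d_add d_scale) (simp add: scale_def fun_eq_iff)

lemma subsp_boundaries [simp]: "subsp (boundaries k)"
  using subspace_image[OF d_linear_into[of k] subspace_chains[OF order_refl]]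
  unfolding boundaries_def subspace_iff by simp

lemma H_projection:
  shows "linear_map class_ring (chain_subspace (cycles k)) (H k) (coset (boundaries k))"
    and "coset (boundaries k) ` cycles k = carrier (H k)"
    and "zero (H k) = boundaries k"
    and "z \<in> cycles k \<Longrightarrow> coset (boundaries k) z = boundaries k \<longleftrightarrow> z \<in> boundaries k"
proof -
  have V: "vectorspace class_ring (chain_subspace (cycles k))"
    by (rule vectorspace_chain_subspace) simp
  have sub: "subspace class_ring (boundaries k) (chain_subspace (cycles k))"
    by (rule subspace_chain_subspace) (simp_all add: boundaries_subset_cycles)
  note quot = vectorspace.quot_space_projection[OF V sub, folded H_eq]
  show zero: "zero (H k) = boundaries k" by (simp add: H_eq quot_space_def)
  show "linear_map class_ring (chain_subspace (cycles k)) (H k) (coset (boundaries k))"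
    using quot(1) by simp
  show "coset (boundaries k) ` cycles k = carrier (H k)" using quot(2) by simp
  show "z \<in> cycles k \<Longrightarrow> coset (boundaries k) z = boundaries k \<longleftrightarrow> z \<in> boundaries k"
    using quot(3)[of z] unfolding zero by simp
qed

lemma vectorspace_H: "vectorspace class_ring (H k)"
  by (rule linear_map.axioms(2)[OF H_projection(1)])

end

locale chain_map = dom: free_complex S d + cod: free_complex T d'
  for S :: "int \<Rightarrow> 'g set" and d :: "int \<Rightarrow> ('g \<Rightarrow> 'f::field) \<Rightarrow> ('g \<Rightarrow> 'f)"
    and T :: "int \<Rightarrow> 'h set" and d' :: "int \<Rightarrow> ('h \<Rightarrow> 'f) \<Rightarrow> ('h \<Rightarrow> 'f)" +
  fixes h :: "int \<Rightarrow> ('g \<Rightarrow> 'f) \<Rightarrow> ('h \<Rightarrow> 'f)"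
  assumes h_linear: "linear_map class_ring (chain_space (S k)) (chain_space (T k)) (h k)"
    and h_comm: "c \<in> chains (S k) \<Longrightarrow> h (k - 1) (d k c) = d' k (h k c)"
begin

lemmas h_closed = linear_map_chains(1)[OF h_linear]
  and h_add = linear_map_chains(2)[OF h_linear]
  and h_zero = linear_map_chains(4)[OF h_linear]
  and h_diff = linear_map_chains(5)[OF h_linear]

lemma h_cycles: "z \<in> dom.cycles k \<Longrightarrow> h k z \<in> cod.cycles k"
  using h_comm[of z k] h_zero[of "k - 1"] h_closed[of z k]
  by (simp add: dom.cycles_def cod.cycles_def)

lemma h_boundaries: "b \<in> dom.boundaries k \<Longrightarrow> h k b \<in> cod.boundaries k"
  using h_comm[of _ "k + 1"] h_closed[of _ "k + 1"]
  by (auto simp: dom.boundaries_def cod.boundaries_def)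

abbreviation H_map :: "int \<Rightarrow> ('g \<Rightarrow> 'f) set \<Rightarrow> ('h \<Rightarrow> 'f) set" where
  "H_map k \<equiv> homology_map (\<lambda>k. chain_space (T k)) d' h k"

lemma H_map_coset:
  assumes "z \<in> dom.cycles k"
  shows "H_map k (coset (dom.boundaries k) z) = coset (cod.boundaries k) (h k z)"
proof -
  have "coset (cod.boundaries k) (h k x) = coset (cod.boundaries k) (h k z)"
    if "x \<in> coset (dom.boundaries k) z" for x
  proof -
    from that obtain b where b: "b \<in> dom.boundaries k" and x: "x = b + z" by (auto simp: coset_def)
    have "h k x = h k b + h k z"
      unfolding x using b assms dom.boundaries_subset[of k] dom.cycles_subset[of k]
      by (intro h_add) blast+
    then have "h k x - h k z = h k b" by simp
    then have "h k x - h k z \<in> cod.boundaries k" using h_boundaries[OF b] by simp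
    then show ?thesis by (rule coset_eqI[OF cod.subsp_boundaries])
  qed
  moreover have "coset (dom.boundaries k) z \<noteq> {}"
    using dom.subsp_boundaries[of k] unfolding subsp_iff coset_def by blast
  ultimately have "(\<Union>x\<in>coset (dom.boundaries k) z. coset (cod.boundaries k) (h k x)) =
      coset (cod.boundaries k) (h k z)"
    by blast
  then show ?thesis by (simp add: homology_map_def cod.im_d)
qed

lemma H_map_linear: "linear_map class_ring (dom.H k) (cod.H k) (H_map k)"
proof (rule linear_map_factor)
  show "linear_map class_ring (chain_subspace (dom.cycles k)) (dom.H k) (coset (dom.boundaries k))"
    by (rule dom.H_projection(1))
  show "coset (dom.boundaries k) ` carrier (chain_subspace (dom.cycles k)) = carrier (dom.H k)"
    using dom.H_projection(2)[of k] by simp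
  have "linear_map class_ring (chain_subspace (dom.cycles k)) (chain_space (T k)) (h k)"
    by (rule linear_map_on_subsp[OF h_linear]) (simp_all add: dom.cycles_subset)
  moreover have "subspace class_ring (cod.cycles k) (chain_space (T k))"
    using cod.subsp_cycles[of k] cod.cycles_subset[of k] unfolding subsp_iff subspace_iff by blast
  ultimately have "linear_map class_ring (chain_subspace (dom.cycles k)) (chain_space (T k)\<lparr>carrier := cod.cycles k\<rparr>) (h k)"
    by (rule linear_map_into_subspace) (use h_cycles[of _ k] in auto)
  then have "linear_map class_ring (chain_subspace (dom.cycles k)) (chain_subspace (cod.cycles k)) (h k)"
    by simp
  then show "linear_map class_ring (chain_subspace (dom.cycles k)) (cod.H k)
      (\<lambda>z. coset (cod.boundaries k) (h k z))"
    by (rule linear_map_comp[OF _ cod.H_projection(1)])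
  show "H_map k (coset (dom.boundaries k) z) = coset (cod.boundaries k) (h k z)"
    if "z \<in> carrier (chain_subspace (dom.cycles k))" for z
    using H_map_coset[of z k] that by simp
qed

lemma H_map_hom: "mod_hom class_ring (dom.H k) (cod.H k) (H_map k)"
  by (rule linear_map.axioms(3)[OF H_map_linear])

end

section \<open>Relative cycles and relative boundaries\<close>

text \<open>The boundary map of the subcomplex is that of the whole complex, so the inclusion is given by the
  identity on chains.\<close>

locale complex_pair = sub: free_complex S d + tot: free_complex T d
  for S T :: "int \<Rightarrow> 'g set" and d :: "int \<Rightarrow> ('g \<Rightarrow> 'f::field) \<Rightarrow> ('g \<Rightarrow> 'f)" +
  assumes sub_tot: "S k \<subseteq> T k" and finite_tot: "finite (T k)"
begin

lemma chains_sub: "chains (S k) \<subseteq> chains (T k)"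
  by (rule chains_mono[OF sub_tot])

lemma inclusion: "chain_map S d T d (\<lambda>k c. c)"
proof (intro chain_map.intro chain_map_axioms.intro sub.free_complex_axioms tot.free_complex_axioms)
  fix k
  have id: "linear_map class_ring (chain_space (T k)) (chain_space (T k)) (\<lambda>c. c)"
    by (rule linear_mapI) (simp_all add: vectorspace_chain_space)
  show "linear_map class_ring (chain_space (S k)) (chain_space (T k)) (\<lambda>c. c)"
    using linear_map_on_subsp[OF id subsp_chains chains_sub] by (simp add: chain_subspace_chains)
qed (rule refl)

sublocale incl: chain_map S d T d "\<lambda>k c. c"
  by (rule inclusion)

definition rel_cycles :: "int \<Rightarrow> ('g \<Rightarrow> 'f) set" where
  "rel_cycles k = {x \<in> chains (T k). d k x \<in> chains (S (k - 1))}"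

definition rel_boundaries :: "int \<Rightarrow> ('g \<Rightarrow> 'f) set" where
  "rel_boundaries k = {a + b | a b. a \<in> chains (S k) \<and> b \<in> tot.boundaries k}"

lemma subsp_rel_cycles: "subsp (rel_cycles k)"
  unfolding subsp_iff rel_cycles_def
  by (simp add: tot.d_zero tot.d_add tot.d_scale subspD[OF subsp_chains])

lemma subsp_rel_boundaries: "subsp (rel_boundaries k)"
  unfolding subsp_iff
proof (intro conjI ballI allI)
  note S = subspD[OF subsp_chains[of "S k"]] and B = subspD[OF tot.subsp_boundaries[of k]]
  have "0 = 0 + (0 :: 'g \<Rightarrow> 'f)" by simp
  then show "0 \<in> rel_boundaries k" unfolding rel_boundaries_def using S(1) B(1) by blast
  fix u assume "u \<in> rel_boundaries k"
  then obtain a b where ab: "a \<in> chains (S k)" "b \<in> tot.boundaries k" "u = a + b"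
    unfolding rel_boundaries_def by blast
  have "scale r u = scale r a + scale r b" for r
    by (simp add: ab(3) scale_def fun_eq_iff algebra_simps)
  then show "scale r u \<in> rel_boundaries k" for r
    unfolding rel_boundaries_def using S(3)[OF ab(1)] B(3)[OF ab(2)] by blast
  fix v assume "v \<in> rel_boundaries k"
  then obtain a' b' where ab': "a' \<in> chains (S k)" "b' \<in> tot.boundaries k" "v = a' + b'"
    unfolding rel_boundaries_def by blast
  have "u + v = (a + a') + (b + b')" by (simp add: ab(3) ab'(3))
  then show "u + v \<in> rel_boundaries k"
    unfolding rel_boundaries_def using S(2)[OF ab(1) ab'(1)] B(2)[OF ab(2) ab'(2)] by blast
qed

lemma rel_boundaries_subset: "rel_boundaries k \<subseteq> chains (T k)"
proof
  fix u assume "u \<in> rel_boundaries k"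
  then obtain a b where ab: "a \<in> chains (S k)" "b \<in> tot.boundaries k" "u = a + b"
    unfolding rel_boundaries_def by blast
  then have "a \<in> chains (T k)" "b \<in> chains (T k)"
    using chains_sub tot.boundaries_subset by blast+
  then show "u \<in> chains (T k)" unfolding ab(3) by (rule subspD[OF subsp_chains])
qed

lemma chains_sub_rel_boundaries: "chains (S k) \<subseteq> rel_boundaries k"
proof
  fix a :: "'g \<Rightarrow> 'f" assume "a \<in> chains (S k)"
  moreover have "a = a + 0" "0 \<in> tot.boundaries k"
    using subspD(1)[OF tot.subsp_boundaries] by simp_all
  ultimately show "a \<in> rel_boundaries k" unfolding rel_boundaries_def by blast
qed

text \<open>A class is in the kernel if its cycles bound in the whole complex; such cycles are the chains of the
  subcomplex that are boundaries of the whole complex.\<close>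

lemma dim_ker_eta:
  "vectorspace.dim class_ring ((sub.H k)\<lparr>carrier := mod_hom.ker (sub.H k) (tot.H k) (incl.H_map k)\<rparr>)
     + subdim (sub.boundaries k) = subdim (chains (S k) \<inter> tot.boundaries k)"
proof -
  let ?U = "chains (S k) \<inter> tot.boundaries k"
  have U: "subsp ?U"
    using subsp_chains[of "S k"] tot.subsp_boundaries[of k] unfolding subsp_iff by blast
  have U_cycles: "?U \<subseteq> sub.cycles k"
    using tot.boundaries_subset_cycles[of k] by (auto simp: tot.cycles_def sub.cycles_def)
  have B_U: "sub.boundaries k \<subseteq> ?U"
    using incl.h_boundaries[of _ k] sub.boundaries_subset[of k] by blast
  have "subspace class_ring ?U (chain_subspace (sub.cycles k))"
    by (rule subspace_chain_subspace[OF sub.subsp_cycles U U_cycles])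
  from linear_map_restrict[OF sub.H_projection(1) this]
  have lin: "linear_map class_ring (chain_subspace ?U) (sub.H k) (coset (sub.boundaries k))"
    by simp
  have "finite (S k)" using finite_subset[OF sub_tot finite_tot] .
  note rn = rank_nullity_subdim[OF this U Int_lower1 lin]
  have "{u \<in> ?U. coset (sub.boundaries k) u = zero (sub.H k)} = sub.boundaries k"
    using B_U U_cycles sub.H_projection(4)[of _ k] unfolding sub.H_projection(3) by blast
  moreover have "mod_hom.ker (sub.H k) (tot.H k) (incl.H_map k) = coset (sub.boundaries k) ` ?U"
  proof -
    have "incl.H_map k (coset (sub.boundaries k) z) = zero (tot.H k) \<longleftrightarrow> z \<in> ?U"
      if "z \<in> sub.cycles k" for z
      using incl.h_cycles[OF that] that tot.H_projection(4)[of z k] sub.cycles_subset[of k]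
      unfolding incl.H_map_coset[OF that] tot.H_projection(3) by blast
    then show ?thesis
      unfolding mod_hom.ker_def[OF incl.H_map_hom] sub.H_projection(2)[symmetric] using U_cycles by blast
  qed
  ultimately show ?thesis using rn by simp
qed

text \<open>The cokernel is the space of cycles modulo the sums of cycles of the subcomplex and boundaries. A cycle
  that is a relative boundary is such a sum, since its summand in the subcomplex is then a cycle as well.\<close>

lemma dim_coker_eta:
  "vectorspace.dim class_ring (quot_space (tot.H k) (mod_hom.im (sub.H k) (incl.H_map k)))
     + subdim (tot.cycles k \<inter> rel_boundaries k) = subdim (tot.cycles k)"
proof -
  let ?I = "mod_hom.im (sub.H k) (incl.H_map k)"
  have I: "?I = coset (tot.boundaries k) ` sub.cycles k"
    unfolding mod_hom.im_def[OF incl.H_map_hom] sub.H_projection(2)[symmetric] image_image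
    by (rule image_cong[OF refl]) (rule incl.H_map_coset)
  have subI: "subspace class_ring ?I (tot.H k)"
    by (rule linear_map.imT_is_subspace[OF incl.H_map_linear])
  note quot = vectorspace.quot_space_projection[OF tot.vectorspace_H subI]
  let ?Q = "quot_space (tot.H k) ?I"
  let ?\<psi> = "\<lambda>z. ?I +>\<^bsub>tot.H k\<^esub> coset (tot.boundaries k) z"
  have lin: "linear_map class_ring (chain_subspace (tot.cycles k)) ?Q ?\<psi>"
    by (rule linear_map_comp[OF tot.H_projection(1) quot(1)])
  note rn = rank_nullity_subdim[OF finite_tot tot.subsp_cycles tot.cycles_subset lin]
  have im: "?\<psi> ` tot.cycles k = carrier ?Q"
    unfolding quot(2)[symmetric] tot.H_projection(2)[symmetric] image_image ..
  have "?\<psi> z = zero ?Q \<longleftrightarrow> z \<in> rel_boundaries k" if z: "z \<in> tot.cycles k" for z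
  proof -
    have "coset (tot.boundaries k) z \<in> carrier (tot.H k)"
      using tot.H_projection(2)[of k] z by blast
    then have "?\<psi> z = zero ?Q \<longleftrightarrow> coset (tot.boundaries k) z \<in> ?I" by (rule quot(3))
    also have "\<dots> \<longleftrightarrow> (\<exists>a\<in>sub.cycles k. z - a \<in> tot.boundaries k)"
      unfolding I image_iff coset_eq_iff[OF tot.subsp_boundaries] ..
    also have "\<dots> \<longleftrightarrow> z \<in> rel_boundaries k"
    proof
      assume "\<exists>a\<in>sub.cycles k. z - a \<in> tot.boundaries k"
      then obtain a where a: "a \<in> sub.cycles k" "z - a \<in> tot.boundaries k" by (rule bexE)
      have "z = a + (z - a)" by simp
      then show "z \<in> rel_boundaries k"
        unfolding rel_boundaries_def using a sub.cycles_subset[of k] by blast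
    next
      assume "z \<in> rel_boundaries k"
      then obtain a b where ab: "a \<in> chains (S k)" "b \<in> tot.boundaries k" "z = a + b"
        unfolding rel_boundaries_def by blast
      have "z - b \<in> tot.cycles k"
        using tot.boundaries_subset_cycles[of k] ab(2) by (intro subsp_diff[OF tot.subsp_cycles z]) blast
      then have "a \<in> tot.cycles k" using ab(3) by simp
      then have "a \<in> sub.cycles k" using ab(1) by (simp add: tot.cycles_def sub.cycles_def)
      moreover have "z - a \<in> tot.boundaries k" using ab by simp
      ultimately show "\<exists>a\<in>sub.cycles k. z - a \<in> tot.boundaries k" by (intro bexI)
    qed
    finally show ?thesis .
  qed
  then have "{z \<in> tot.cycles k. ?\<psi> z = zero ?Q} = tot.cycles k \<inter> rel_boundaries k" by blast
  then show ?thesis using rn im by simp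
qed

lemma dim_rel_cycles:
  "subdim (chains (S (k - 1)) \<inter> tot.boundaries (k - 1)) + subdim (tot.cycles k) = subdim (rel_cycles k)"
proof -
  have R: "rel_cycles k \<subseteq> chains (T k)" by (auto simp: rel_cycles_def)
  note rn = rank_nullity_subdim[OF finite_tot subsp_rel_cycles R
      linear_map_on_subsp[OF tot.d_linear subsp_rel_cycles R]]
  have "d k ` rel_cycles k = chains (S (k - 1)) \<inter> tot.boundaries (k - 1)"
    by (auto simp: rel_cycles_def tot.boundaries_def)
  moreover have "0 \<in> chains (S (k - 1))" by (rule subspD[OF subsp_chains])
  then have "{u \<in> rel_cycles k. d k u = 0} = tot.cycles k"
    by (auto simp: rel_cycles_def tot.cycles_def)
  ultimately show ?thesis using rn by (simp add: subdim_def)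
qed

lemma dim_rel_boundaries:
  "subdim (sub.boundaries (k - 1)) + subdim (tot.cycles k \<inter> rel_boundaries k) = subdim (rel_boundaries k)"
proof -
  note rn = rank_nullity_subdim[OF finite_tot subsp_rel_boundaries rel_boundaries_subset
      linear_map_on_subsp[OF tot.d_linear subsp_rel_boundaries rel_boundaries_subset]]
  have "d k (a + b) = d k a" if "a \<in> chains (S k)" "b \<in> tot.boundaries k" for a b
  proof -
    have "a \<in> chains (T k)" "b \<in> chains (T k)" "d k b = 0"
      using that chains_sub[of k] tot.boundaries_subset_cycles[of k] by (auto simp: tot.cycles_def)
    then show ?thesis by (simp add: tot.d_add)
  qed
  then have "d k ` rel_boundaries k \<subseteq> d k ` chains (S k)"
    unfolding rel_boundaries_def by auto
  moreover have "d k ` chains (S k) \<subseteq> d k ` rel_boundaries k"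
    by (rule image_mono[OF chains_sub_rel_boundaries])
  ultimately have "d k ` rel_boundaries k = sub.boundaries (k - 1)"
    by (simp add: sub.boundaries_def)
  moreover have "{u \<in> rel_boundaries k. d k u = 0} = tot.cycles k \<inter> rel_boundaries k"
    using rel_boundaries_subset[of k] by (auto simp: tot.cycles_def)
  ultimately show ?thesis using rn[of k] by (simp add: subdim_def)
qed

text \<open>The boundary map sends relative cycles onto the cycles that make up the kernel of \<open>\<eta>\<close> in degree
  \<open>k - 1\<close>, and relative boundaries onto the boundaries that are divided out there; the quotient of its kernels
  on the two spaces is the cokernel in degree \<open>k\<close>. So the difference of the dimensions of the two spaces,
  which is the dimension of the relative homology, is the sum of the two summands of \<open>\<delta>\<close>.\<close>

lemma dim_relative_homology:
  "vectorspace.dim class_ring ((sub.H (k - 1))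
      \<lparr>carrier := mod_hom.ker (sub.H (k - 1)) (tot.H (k - 1)) (incl.H_map (k - 1))\<rparr>)
    + vectorspace.dim class_ring (quot_space (tot.H k) (mod_hom.im (sub.H k) (incl.H_map k)))
    + subdim (rel_boundaries k) = subdim (rel_cycles k)"
  using dim_ker_eta[of "k - 1"] dim_coker_eta[of k] dim_rel_cycles[of k] dim_rel_boundaries[of k]
  by linarith

end

text \<open>By the hypothesis \<open>inj\<close>, the map from relative cycles to the chains of \<open>Y\<close> modulo relative boundaries
  kills relative boundaries only. Its target is a quotient of the chains of \<open>Y\<close> modulo those of \<open>E\<close>.\<close>

lemma relative_dim_bound:
  fixes h :: "('g \<Rightarrow> 'f::field) \<Rightarrow> ('h \<Rightarrow> 'f)"
  assumes "complex_pair A X d" "complex_pair E Y d'"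
    and h: "linear_map class_ring (chain_space (X k)) (chain_space (Y k)) h"
    and inj: "\<And>x. x \<in> complex_pair.rel_cycles A X d k \<Longrightarrow> h x \<in> complex_pair.rel_boundaries E Y d' k \<Longrightarrow>
      x \<in> complex_pair.rel_boundaries A X d k"
  shows "subdim (complex_pair.rel_cycles A X d k) + subdim (chains (E k) :: ('h \<Rightarrow> 'f) set)
    \<le> subdim (complex_pair.rel_boundaries A X d k) + subdim (chains (Y k) :: ('h \<Rightarrow> 'f) set)"
proof -
  interpret AX: complex_pair A X d by fact
  interpret EY: complex_pair E Y d' by fact
  let ?Y = "chain_space (Y k) :: ('f, 'h \<Rightarrow> 'f) module"
  let ?Q = "quot_space ?Y (EY.rel_boundaries k)"
  have M: "subspace class_ring (EY.rel_boundaries k) ?Y"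
    using EY.subsp_rel_boundaries[of k] EY.rel_boundaries_subset[of k] unfolding subsp_iff subspace_iff by blast
  note quot = vectorspace.quot_space_projection[OF vectorspace_chain_space M]
  note fin = fin_dim_chain_space[OF EY.finite_tot]
  have R: "AX.rel_cycles k \<subseteq> chains (X k)" by (auto simp: AX.rel_cycles_def)
  have lin: "linear_map class_ring (chain_subspace (AX.rel_cycles k)) ?Q
      (\<lambda>x. EY.rel_boundaries k +>\<^bsub>?Y\<^esub> h x)"
    by (rule linear_map_comp[OF linear_map_on_subsp[OF h AX.subsp_rel_cycles R] quot(1)])
  let ?\<phi> = "\<lambda>x. EY.rel_boundaries k +>\<^bsub>?Y\<^esub> h x"
  have Q: "vectorspace class_ring ?Q" by (rule linear_map.axioms(2)[OF quot(1)])
  have im: "subspace class_ring (?\<phi> ` AX.rel_cycles k) ?Q"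
    using linear_map.imT_is_subspace[OF lin]
    unfolding mod_hom.im_def[OF linear_map.axioms(3)[OF lin]] by simp
  note finQ = vectorspace.dim_quot_space(2)[OF vectorspace_chain_space fin M]
  have "vectorspace.dim class_ring (?Q\<lparr>carrier := ?\<phi> ` AX.rel_cycles k\<rparr>) \<le> vectorspace.dim class_ring ?Q"
    by (rule vectorspace.subspace_dim[OF Q im finQ vectorspace.fin_dim_subspace[OF Q finQ im]])
  moreover have "vectorspace.dim class_ring (?Q\<lparr>carrier := ?\<phi> ` AX.rel_cycles k\<rparr>)
      + subdim {x \<in> AX.rel_cycles k. ?\<phi> x = zero ?Q} = subdim (AX.rel_cycles k)"
    by (rule rank_nullity_subdim[OF AX.finite_tot AX.subsp_rel_cycles R lin])
  moreover have "subdim {x \<in> AX.rel_cycles k. ?\<phi> x = zero ?Q} \<le> subdim (AX.rel_boundaries k)"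
  proof (rule subdim_mono[OF AX.finite_tot _ AX.subsp_rel_boundaries _ AX.rel_boundaries_subset])
    have "{x \<in> AX.rel_cycles k. ?\<phi> x = zero ?Q} =
        mod_hom.ker (chain_subspace (AX.rel_cycles k)) ?Q ?\<phi>"
      unfolding mod_hom.ker_def[OF linear_map.axioms(3)[OF lin]] by simp
    moreover have "subspace class_ring (mod_hom.ker (chain_subspace (AX.rel_cycles k)) ?Q ?\<phi>)
        (chain_subspace (AX.rel_cycles k))"
      by (rule linear_map.kerT_is_subspace[OF lin])
    ultimately show "subsp {x \<in> AX.rel_cycles k. ?\<phi> x = zero ?Q}"
      unfolding subsp_iff by (simp add: subspace_def submodule_def)
    show "{x \<in> AX.rel_cycles k. ?\<phi> x = zero ?Q} \<subseteq> AX.rel_boundaries k"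
    proof clarify
      fix x assume x: "x \<in> AX.rel_cycles k" "?\<phi> x = zero ?Q"
      have "h x \<in> chains (Y k)" using x(1) R by (intro linear_map_chains(1)[OF h]) blast
      then have "h x \<in> EY.rel_boundaries k" using quot(3) x(2) by blast
      then show "x \<in> AX.rel_boundaries k" by (rule inj[OF x(1)])
    qed
  qed
  moreover have "vectorspace.dim class_ring ?Q + subdim (EY.rel_boundaries k) = subdim (chains (Y k) :: ('h \<Rightarrow> 'f) set)"
    using vectorspace.dim_quot_space(1)[OF vectorspace_chain_space fin M]
    by (simp add: subdim_def chain_subspace_chains)
  moreover have "subdim (chains (E k) :: ('h \<Rightarrow> 'f) set) \<le> subdim (EY.rel_boundaries k)"
    by (rule subdim_mono[OF EY.finite_tot subsp_chains EY.subsp_rel_boundaries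
          EY.chains_sub_rel_boundaries EY.rel_boundaries_subset])
  ultimately show ?thesis by linarith
qed

section \<open>Exactness of the mapping cone\<close>

text \<open>In the mapping cone of \<open>h\<close>, a pair \<open>(x, y)\<close> of a \<open>(k - 1)\<close>-chain of the source and a \<open>k\<close>-chain of the
  target is a cycle if \<open>x\<close> is a cycle and \<open>h x\<close> is the boundary of \<open>y\<close>. Exactness at \<open>(x, y)\<close> combines
  two properties of the map on homology: injectivity in degree \<open>k - 1\<close> (the class of \<open>x\<close> vanishes) and
  surjectivity in degree \<open>k\<close> (take \<open>x = 0\<close>). The differential of the cone is written up to signs, which do not
  affect exactness.\<close>

definition cone_exact ::
  "(int \<Rightarrow> 'g set) \<Rightarrow> (int \<Rightarrow> ('g \<Rightarrow> 'f::field) \<Rightarrow> ('g \<Rightarrow> 'f)) \<Rightarrow>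
    (int \<Rightarrow> 'h set) \<Rightarrow> (int \<Rightarrow> ('h \<Rightarrow> 'f) \<Rightarrow> ('h \<Rightarrow> 'f)) \<Rightarrow>
    (int \<Rightarrow> ('g \<Rightarrow> 'f) \<Rightarrow> ('h \<Rightarrow> 'f)) \<Rightarrow> int \<Rightarrow> bool" where
  "cone_exact S d T d' h k \<longleftrightarrow>
    (\<forall>x\<in>chains (S (k - 1)). \<forall>y\<in>chains (T k). d (k - 1) x = 0 \<longrightarrow> h (k - 1) x = d' k y \<longrightarrow>
      (\<exists>x'\<in>chains (S k). \<exists>y'\<in>chains (T (k + 1)). d k x' = x \<and> h k x' + d' (k + 1) y' = y))"

lemma cone_exactD:
  assumes "cone_exact S d T d' h k" "x \<in> chains (S (k - 1))" "y \<in> chains (T k)"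
    and "d (k - 1) x = 0" "h (k - 1) x = d' k y"
  obtains x' y' where "x' \<in> chains (S k)" "y' \<in> chains (T (k + 1))" "d k x' = x" "h k x' + d' (k + 1) y' = y"
  using assms unfolding cone_exact_def by blast

text \<open>Injectivity yields a chain \<open>a\<close> with boundary \<open>x\<close>. Then \<open>y\<close> and the image of \<open>a\<close> differ by a cycle, which
  by surjectivity is the image of a cycle up to a boundary.\<close>

lemma (in chain_map) cone_exactI:
  assumes inj: "inj_on (H_map (k - 1)) (carrier (dom.H (k - 1)))"
    and surj: "carrier (cod.H k) \<subseteq> H_map k ` carrier (dom.H k)"
  shows "cone_exact S d T d' h k"
  unfolding cone_exact_def
proof (intro ballI impI)
  fix x y assume x: "x \<in> chains (S (k - 1))" and y: "y \<in> chains (T k)"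
    and dx: "d (k - 1) x = 0" and hx: "h (k - 1) x = d' k y"
  have xZ: "x \<in> dom.cycles (k - 1)" and zZ: "0 \<in> dom.cycles (k - 1)"
    using x dx subspD(1)[OF dom.subsp_cycles] by (simp_all add: dom.cycles_def)
  have "h (k - 1) x \<in> cod.boundaries (k - 1)"
    unfolding hx cod.boundaries_def using y by simp
  then have "coset (cod.boundaries (k - 1)) (h (k - 1) x) = coset (cod.boundaries (k - 1)) (h (k - 1) 0)"
    by (intro coset_eqI[OF cod.subsp_boundaries]) (simp add: h_zero)
  then have "H_map (k - 1) (coset (dom.boundaries (k - 1)) x) = H_map (k - 1) (coset (dom.boundaries (k - 1)) 0)"
    unfolding H_map_coset[OF xZ] H_map_coset[OF zZ] .
  then have "coset (dom.boundaries (k - 1)) x = coset (dom.boundaries (k - 1)) 0"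
    by (rule inj_onD[OF inj]) (unfold dom.H_projection(2)[symmetric], rule imageI[OF xZ], rule imageI[OF zZ])
  then have "x - 0 \<in> dom.boundaries (k - 1)" by (simp only: coset_eq_iff[OF dom.subsp_boundaries])
  then obtain a where a: "a \<in> chains (S k)" "d k a = x" by (auto simp: dom.boundaries_def)
  have "d' k (y - h k a) = 0"
    using y a h_closed[OF a(1)] h_comm[OF a(1)] hx by (simp add: cod.d_diff)
  moreover have "y - h k a \<in> chains (T k)" by (rule subsp_diff[OF subsp_chains y h_closed[OF a(1)]])
  ultimately have "y - h k a \<in> cod.cycles k" by (simp add: cod.cycles_def)
  then have "coset (cod.boundaries k) (y - h k a) \<in> carrier (cod.H k)"
    unfolding cod.H_projection(2)[symmetric] by (rule imageI)
  then have "coset (cod.boundaries k) (y - h k a) \<in> H_map k ` coset (dom.boundaries k) ` dom.cycles k"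
    using surj unfolding dom.H_projection(2) by (rule set_rev_mp)
  then obtain z where z: "z \<in> dom.cycles k"
    and "coset (cod.boundaries k) (y - h k a) = H_map k (coset (dom.boundaries k) z)"
    by (elim imageE) simp
  then have "coset (cod.boundaries k) (y - h k a) = coset (cod.boundaries k) (h k z)"
    by (simp only: H_map_coset)
  then have "y - h k a - h k z \<in> cod.boundaries k" by (simp only: coset_eq_iff[OF cod.subsp_boundaries])
  then obtain y' where y': "y' \<in> chains (T (k + 1))" "y - h k a - h k z = d' (k + 1) y'"
    unfolding cod.boundaries_def by (elim imageE) simp
  have zS: "z \<in> chains (S k)" "d k z = 0" using z by (simp_all add: dom.cycles_def)
  show "\<exists>x'\<in>chains (S k). \<exists>y'\<in>chains (T (k + 1)). d k x' = x \<and> h k x' + d' (k + 1) y' = y"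
  proof (intro bexI conjI)
    show "a + z \<in> chains (S k)" by (rule subspD(2)[OF subsp_chains a(1) zS(1)])
    show "y' \<in> chains (T (k + 1))" by fact
    show "d k (a + z) = x" by (simp add: dom.d_add a zS)
    show "h k (a + z) + d' (k + 1) y' = y" by (simp add: h_add a zS flip: y'(2))
  qed
qed

lemma cone_exact_cong:
  assumes "cone_exact S d T d' h k" and eq: "\<And>j c. c \<in> chains (S j) \<Longrightarrow> h' j c = h j c"
  shows "cone_exact S d T d' h' k"
  unfolding cone_exact_def
proof (intro ballI impI)
  fix x y assume x: "x \<in> chains (S (k - 1))" and y: "y \<in> chains (T k)"
    and dx: "d (k - 1) x = 0" and "h' (k - 1) x = d' k y"
  then have "h (k - 1) x = d' k y" by (simp only: eq)
  then obtain x' y' where "x' \<in> chains (S k)" "y' \<in> chains (T (k + 1))" "d k x' = x"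
    "h k x' + d' (k + 1) y' = y"
    by (rule cone_exactD[OF assms(1) x y dx])
  then show "\<exists>x'\<in>chains (S k). \<exists>y'\<in>chains (T (k + 1)). d k x' = x \<and> h' k x' + d' (k + 1) y' = y"
    by (intro bexI[of _ x'] bexI[of _ y']) (simp_all add: eq)
qed

text \<open>The injectivity part of the five lemma. Since \<open>x\<close> is mapped to \<open>e\<close> plus a boundary, \<open>(\<partial>x, e)\<close> is a
  cycle of the cone of \<open>A \<rightarrow> E\<close>, hence a boundary; this yields a chain \<open>a\<close> of \<open>A\<close> such that \<open>x - a\<close> is a
  cycle with image a boundary. By exactness of the cone of \<open>X \<rightarrow> Y\<close>, \<open>x - a\<close> is a boundary.\<close>

lemma relative_injective:
  assumes "complex_pair A X d" "complex_pair E Y d'" "chain_map X d Y d' h"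
    and exA: "cone_exact A d E d' h k" and exX: "cone_exact X d Y d' h (k + 1)"
    and x: "x \<in> complex_pair.rel_cycles A X d k" and hx: "h k x \<in> complex_pair.rel_boundaries E Y d' k"
  shows "x \<in> complex_pair.rel_boundaries A X d k"
proof -
  interpret AX: complex_pair A X d by fact
  interpret EY: complex_pair E Y d' by fact
  interpret h: chain_map X d Y d' h by fact
  have xX: "x \<in> chains (X k)" and dx: "d k x \<in> chains (A (k - 1))"
    using x by (simp_all add: AX.rel_cycles_def)
  obtain e y where e: "e \<in> chains (E k)" and y: "y \<in> chains (Y (k + 1))" and hx: "h k x = e + d' (k + 1) y"
    using hx unfolding EY.rel_boundaries_def EY.tot.boundaries_def by blast
  have eY: "e \<in> chains (Y k)" using EY.chains_sub e by blast
  have dy: "d' (k + 1) y \<in> chains (Y k)" using EY.tot.d_closed[OF y] by simp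
  have ddy: "d' k (d' (k + 1) y) = 0" using EY.tot.d_d[OF y] by simp
  have "h (k - 1) (d k x) = d' k e"
    unfolding h.h_comm[OF xX] hx EY.tot.d_add[OF eY dy] ddy by simp
  then obtain a e' where a: "a \<in> chains (A k)" and e': "e' \<in> chains (E (k + 1))"
    and da: "d k a = d k x" and ae: "h k a + d' (k + 1) e' = e"
    by (rule cone_exactD[OF exA dx e AX.tot.d_d[OF xX]])
  have aX: "a \<in> chains (X k)" and e'Y: "e' \<in> chains (Y (k + 1))"
    using a e' AX.chains_sub EY.chains_sub by blast+
  have xa: "x - a \<in> chains (X (k + 1 - 1))" using subsp_diff[OF subsp_chains xX aX] by simp
  have ye: "e' + y \<in> chains (Y (k + 1))" by (rule subspD(2)[OF subsp_chains e'Y y])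
  have "d (k + 1 - 1) (x - a) = 0" by (simp add: AX.tot.d_diff xX aX da)
  moreover have "h (k + 1 - 1) (x - a) = d' (k + 1) (e' + y)"
    by (simp add: h.h_diff[OF xX aX] EY.tot.d_add[OF e'Y y] hx flip: ae)
  ultimately obtain x' where x': "x' \<in> chains (X (k + 1))" "d (k + 1) x' = x - a"
    by (rule cone_exactD[OF exX xa ye])
  have "x = a + d (k + 1) x'" by (simp add: x')
  moreover have "d (k + 1) x' \<in> AX.tot.boundaries k" unfolding AX.tot.boundaries_def using x'(1) by (rule imageI)
  ultimately show ?thesis unfolding AX.rel_boundaries_def using a by blast
qed

lemma chains_UnE:
  assumes "x \<in> chains (S \<union> T)"
  obtains x1 x2 where "x1 \<in> chains S" "x2 \<in> chains T" "x = x1 + x2"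
proof
  show "(\<lambda>g. if g \<in> S then x g else 0) \<in> chains S" by (simp add: chains_iff)
  show "(\<lambda>g. if g \<in> S then 0 else x g) \<in> chains T" using assms by (simp add: chains_iff)
  show "x = (\<lambda>g. if g \<in> S then x g else 0) + (\<lambda>g. if g \<in> S then 0 else x g)"
    by (simp add: fun_eq_iff)
qed

lemma chains_Int: "x \<in> chains S \<Longrightarrow> x \<in> chains T \<Longrightarrow> x \<in> chains (S \<inter> T)"
  by (auto simp: chains_iff)

text \<open>Exactness of the Mayer-Vietoris sequence for cones. A cycle of the cone of the sum splits into two pairs
  of chains, one in each summand. The differentials of the two pairs are opposite and so lie in the
  intersection, where exactness one degree lower makes them the differential of a pair \<open>(u, w)\<close>. Correcting
  the two pairs by \<open>(u, w)\<close> turns them into cycles, to which exactness for the summands applies.\<close>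

lemma cone_exact_union:
  assumes cm: "chain_map (\<lambda>k. S1 k \<union> S2 k) d (\<lambda>k. T1 k \<union> T2 k) d' h"
    and cm1: "chain_map S1 d T1 d' h" and cm2: "chain_map S2 d T2 d' h"
    and ex1: "cone_exact S1 d T1 d' h k" and ex2: "cone_exact S2 d T2 d' h k"
    and ex12: "cone_exact (\<lambda>k. S1 k \<inter> S2 k) d (\<lambda>k. T1 k \<inter> T2 k) d' h (k - 1)"
  shows "cone_exact (\<lambda>k. S1 k \<union> S2 k) d (\<lambda>k. T1 k \<union> T2 k) d' h k"
  unfolding cone_exact_def
proof (intro ballI impI)
  interpret chain_map "\<lambda>k. S1 k \<union> S2 k" d "\<lambda>k. T1 k \<union> T2 k" d' h by fact
  interpret h1: chain_map S1 d T1 d' h by fact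
  interpret h2: chain_map S2 d T2 d' h by fact
  have sub: "chains (S1 j) \<subseteq> chains (S1 j \<union> S2 j)" "chains (S2 j) \<subseteq> chains (S1 j \<union> S2 j)"
    "chains (T1 j) \<subseteq> chains (T1 j \<union> T2 j)" "chains (T2 j) \<subseteq> chains (T1 j \<union> T2 j)"
    "chains (S1 j \<inter> S2 j) \<subseteq> chains (S1 j)" "chains (S1 j \<inter> S2 j) \<subseteq> chains (S2 j)"
    "chains (T1 j \<inter> T2 j) \<subseteq> chains (T1 j)" "chains (T1 j \<inter> T2 j) \<subseteq> chains (T2 j)" for j
    by (simp_all add: chains_mono)
  fix x y assume x: "x \<in> chains (S1 (k - 1) \<union> S2 (k - 1))" and y: "y \<in> chains (T1 k \<union> T2 k)"
    and dx: "d (k - 1) x = 0" and hx: "h (k - 1) x = d' k y"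
  obtain x1 x2 where x1: "x1 \<in> chains (S1 (k - 1))" and x2: "x2 \<in> chains (S2 (k - 1))" and xx: "x = x1 + x2"
    using x by (rule chains_UnE)
  obtain y1 y2 where y1: "y1 \<in> chains (T1 k)" and y2: "y2 \<in> chains (T2 k)" and yy: "y = y1 + y2"
    using y by (rule chains_UnE)
  have inS: "x1 \<in> chains (S1 (k - 1) \<union> S2 (k - 1))" "x2 \<in> chains (S1 (k - 1) \<union> S2 (k - 1))"
    using x1 x2 sub by blast+
  have inT: "y1 \<in> chains (T1 k \<union> T2 k)" "y2 \<in> chains (T1 k \<union> T2 k)"
    using y1 y2 sub by blast+
  have dxx: "d (k - 1) x1 + d (k - 1) x2 = 0"
    using dx unfolding xx dom.d_add[OF inS] .
  have hxx: "h (k - 1) x1 + h (k - 1) x2 = d' k y1 + d' k y2"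
    using hx unfolding xx yy h_add[OF inS] cod.d_add[OF inT] .
  \<comment> \<open>\<open>(x1, y1)\<close> is a cycle of the cone if and only if both \<open>d x1\<close> and \<open>?w\<close> vanish\<close>
  let ?w = "h (k - 1) x1 - d' k y1"
  have "d (k - 1) x1 = 0 - d (k - 1) x2" using dxx by (simp add: eq_neg_iff_add_eq_0)
  then have "d (k - 1) x1 \<in> chains (S2 (k - 1 - 1))"
    using subsp_diff[OF subsp_chains subspD(1)[OF subsp_chains] h2.dom.d_closed[OF x2]] by simp
  then have dx12: "d (k - 1) x1 \<in> chains (S1 (k - 1 - 1) \<inter> S2 (k - 1 - 1))"
    by (rule chains_Int[OF h1.dom.d_closed[OF x1]])
  have w1: "?w \<in> chains (T1 (k - 1))"
    by (rule subsp_diff[OF subsp_chains h1.h_closed[OF x1] h1.cod.d_closed[OF y1]])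
  have "?w = d' k y2 - h (k - 1) x2" using hxx by (simp add: algebra_simps)
  then have "?w \<in> chains (T2 (k - 1))"
    using subsp_diff[OF subsp_chains h2.cod.d_closed[OF y2] h2.h_closed[OF x2]] by simp
  then have w12: "?w \<in> chains (T1 (k - 1) \<inter> T2 (k - 1))" by (rule chains_Int[OF w1])
  have "h (k - 1 - 1) (d (k - 1) x1) = d' (k - 1) ?w"
    unfolding h1.h_comm[OF x1] h1.cod.d_diff[OF h1.h_closed[OF x1] h1.cod.d_closed[OF y1]]
      h1.cod.d_d[OF y1] by simp
  then obtain u w where u: "u \<in> chains (S1 (k - 1) \<inter> S2 (k - 1))"
    and w: "w \<in> chains (T1 (k - 1 + 1) \<inter> T2 (k - 1 + 1))"
    and du: "d (k - 1) u = d (k - 1) x1" and hu: "h (k - 1) u + d' (k - 1 + 1) w = ?w"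
    by (rule cone_exactD[OF ex12 dx12 w12 h1.dom.d_d[OF x1]])
  have u12: "u \<in> chains (S1 (k - 1))" "u \<in> chains (S2 (k - 1))" using u sub by blast+
  have w12: "w \<in> chains (T1 k)" "w \<in> chains (T2 k)" using w sub[of k] unfolding diff_add_cancel by blast+
  have hu: "h (k - 1) u + d' k w = ?w" using hu by simp
  have "d (k - 1) (x1 - u) = 0" by (simp add: h1.dom.d_diff[OF x1 u12(1)] du)
  moreover have "h (k - 1) (x1 - u) = d' k (y1 + w)"
    using hu unfolding h1.h_diff[OF x1 u12(1)] h1.cod.d_add[OF y1 w12(1)] by (simp add: algebra_simps)
  ultimately obtain x1' y1' where 1: "x1' \<in> chains (S1 k)" "y1' \<in> chains (T1 (k + 1))"
    "d k x1' = x1 - u" "h k x1' + d' (k + 1) y1' = y1 + w"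
    by (rule cone_exactD[OF ex1 subsp_diff[OF subsp_chains x1 u12(1)] subspD(2)[OF subsp_chains y1 w12(1)]])
  have "d (k - 1) (x2 + u) = 0"
    unfolding h2.dom.d_add[OF x2 u12(2)] du using dxx by (simp only: add.commute)
  moreover have "h (k - 1) (x2 + u) = d' k (y2 - w)"
  proof -
    have "h (k - 1) x2 = d' k y1 + d' k y2 - h (k - 1) x1"
      using hxx by (simp only: eq_diff_eq add.commute)
    moreover have "h (k - 1) u = h (k - 1) x1 - d' k y1 - d' k w"
      using hu by (simp only: eq_diff_eq)
    ultimately show ?thesis
      unfolding h2.h_add[OF x2 u12(2)] h2.cod.d_diff[OF y2 w12(2)] by simp
  qed
  ultimately obtain x2' y2' where 2: "x2' \<in> chains (S2 k)" "y2' \<in> chains (T2 (k + 1))"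
    "d k x2' = x2 + u" "h k x2' + d' (k + 1) y2' = y2 - w"
    by (rule cone_exactD[OF ex2 subspD(2)[OF subsp_chains x2 u12(2)] subsp_diff[OF subsp_chains y2 w12(2)]])
  have inS': "x1' \<in> chains (S1 k \<union> S2 k)" "x2' \<in> chains (S1 k \<union> S2 k)" using 1 2 sub by blast+
  have inT': "y1' \<in> chains (T1 (k + 1) \<union> T2 (k + 1))" "y2' \<in> chains (T1 (k + 1) \<union> T2 (k + 1))"
    using 1 2 sub by blast+
  show "\<exists>x'\<in>chains (S1 k \<union> S2 k). \<exists>y'\<in>chains (T1 (k + 1) \<union> T2 (k + 1)).
      d k x' = x \<and> h k x' + d' (k + 1) y' = y"
  proof (intro bexI conjI)
    show "x1' + x2' \<in> chains (S1 k \<union> S2 k)" by (rule subspD(2)[OF subsp_chains inS'])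
    show "y1' + y2' \<in> chains (T1 (k + 1) \<union> T2 (k + 1))" by (rule subspD(2)[OF subsp_chains inT'])
    show "d k (x1' + x2') = x" unfolding dom.d_add[OF inS'] 1(3) 2(3) xx by simp
    have "h k (x1' + x2') + d' (k + 1) (y1' + y2') =
        (h k x1' + d' (k + 1) y1') + (h k x2' + d' (k + 1) y2')"
      unfolding h_add[OF inS'] cod.d_add[OF inT'] by (simp add: algebra_simps)
    then show "h k (x1' + x2') + d' (k + 1) (y1' + y2') = y" unfolding 1(4) 2(4) yy by simp
  qed
qed

text \<open>This serves for both the boundary maps of subcomplexes and the restrictions of a chain map.\<close>

lemma linear_map_chains_restrict:
  fixes h :: "('g \<Rightarrow> 'f::field) \<Rightarrow> ('h \<Rightarrow> 'f)"
  assumes h: "linear_map class_ring (chain_space S') (chain_space T') h"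
    and "finite S" "S \<subseteq> S'" "T \<subseteq> T'"
    and gen: "\<And>g. g \<in> S \<Longrightarrow> h (gen_chain g) \<in> chains T"
  shows "linear_map class_ring (chain_space S) (chain_space T) h"
proof -
  have SS': "chains S \<subseteq> (chains S' :: ('g \<Rightarrow> 'f) set)" by (rule chains_mono[OF \<open>S \<subseteq> S'\<close>])
  have lin: "linear_map class_ring (chain_space S) (chain_space T') h"
    using linear_map_on_subsp[OF h subsp_chains SS'] by (simp add: chain_subspace_chains)
  let ?U = "{c \<in> chains S. h c \<in> chains T}"
  have "subsp ?U"
    unfolding subsp_iff using linear_map_chains[OF lin]
    by (simp add: subspD[OF subsp_chains])
  moreover have "gen_chain g \<in> ?U" if "g \<in> S" for g
    using gen[OF that] that by (simp add: chains_iff gen_chain_def)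
  ultimately have "chains S \<subseteq> ?U" by (rule chains_subset_subspace[OF \<open>finite S\<close>])
  then have "h ` chains S \<subseteq> chains T" by blast
  moreover have "subspace class_ring (chains T :: ('h \<Rightarrow> 'f) set) (chain_space T')" by (rule subspace_chains[OF \<open>T \<subseteq> T'\<close>])
  ultimately have "linear_map class_ring (chain_space S) (chain_space T'\<lparr>carrier := chains T\<rparr>) h"
    by (intro linear_map_into_subspace[OF lin])
  then show ?thesis by (simp add: chain_subspace_chains)
qed

section \<open>Bifiltered complexes\<close>

text \<open>For lower sets \<open>P\<close> of values these generators span subcomplexes, which comprise \<open>C\<^sup>p\<close>, \<open>C\<^sup><\<^sup>p\<close> and all
  sums and intersections of them.\<close>

definition gens_in ::
  "('g, 'f::field) bifiltered_complex \<Rightarrow> (real \<times> real) set \<Rightarrow> int \<Rightarrow> 'g set" where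
  "gens_in C P k = {g \<in> gens C k. val C k g \<in> P}"

lemma gens_in_mono: "P \<subseteq> Q \<Longrightarrow> gens_in C P k \<subseteq> gens_in C Q k"
  by (auto simp: gens_in_def)

lemma upto_eq: "upto C p = (\<lambda>k. chain_space (gens_in C {..p} k))"
  by (simp add: fun_eq_iff upto_def upto_gens_def gens_in_def)

lemma below_eq: "below C p = (\<lambda>k. chain_space (gens_in C {..<p} k))"
proof
  fix k
  have "(\<Union>q\<in>{q. q < p}. upto_gens C q k) = gens_in C {..<p} k"
    by (auto simp: upto_gens_def gens_in_def intro: le_less_trans)
  then show "below C p k = chain_space (gens_in C {..<p} k)" by (simp add: below_def)
qed

definition down_closed :: "'a::order set \<Rightarrow> bool" where
  "down_closed P \<longleftrightarrow> (\<forall>v\<in>P. \<forall>w\<le>v. w \<in> P)"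

lemma down_closed_atMost: "down_closed {..p}"
  by (auto simp: down_closed_def)

lemma down_closed_lessThan: "down_closed {..<p}"
  by (auto simp: down_closed_def)

lemma (in bifiltered_chain_complex) free_complex_gens_in:
  assumes P: "down_closed P"
  shows "free_complex (gens_in C P) (bd C)"
proof (rule free_complex.intro)
  fix k
  show "linear_map class_ring (chain_space (gens_in C P k)) (chain_space (gens_in C P (k - 1))) (bd C k)"
  proof (rule linear_map_chains_restrict[OF bd_linear])
    show "finite (gens_in C P k)" using finite_gens by (simp add: gens_in_def)
    show "gens_in C P k \<subseteq> gens C k" "gens_in C P (k - 1) \<subseteq> gens C (k - 1)" by (auto simp: gens_in_def)
    fix g assume g: "g \<in> gens_in C P k"
    then have "bd C k (gen_chain g) \<in> chains (gens C (k - 1))"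
      by (intro linear_map_chains(1)[OF bd_linear]) (simp add: chains_iff gen_chain_def gens_in_def)
    moreover have "val C (k - 1) g' \<in> P" if "g' \<in> gens C (k - 1)" "bd C k (gen_chain g) g' \<noteq> 0" for g'
      using val_mono[of g k g'] g that P unfolding gens_in_def down_closed_def by blast
    ultimately show "bd C k (gen_chain g) \<in> chains (gens_in C P (k - 1))"
      unfolding chains_iff gens_in_def by blast
  qed
next
  fix k and c :: "'g \<Rightarrow> 'f"
  assume "c \<in> chains (gens_in C P k)"
  then have "c \<in> chains (gens C k)" by (rule subsetD[OF chains_mono, rotated]) (auto simp: gens_in_def)
  from bd_bd[OF this] show "bd C (k - 1) (bd C k c) = 0" by (simp add: zero_fun_def)
qed

lemma (in bifiltered_chain_complex) complex_pair_gens_in: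
  assumes "down_closed P" "down_closed Q" "P \<subseteq> Q"
  shows "complex_pair (gens_in C P) (gens_in C Q) (bd C)"
proof (intro complex_pair.intro complex_pair_axioms.intro free_complex_gens_in assms)
  show "gens_in C P k \<subseteq> gens_in C Q k" for k by (rule gens_in_mono[OF assms(3)])
  show "finite (gens_in C Q k)" for k using finite_gens by (simp add: gens_in_def)
qed

lemma (in bifiltered_chain_complex) finite_vals: "finite (\<Union>k. val C k ` gens C k)"
proof -
  obtain n :: nat where n: "\<And>k. k \<notin> {0..int n} \<Longrightarrow> gens C k = {}" using gens_bounded by blast
  have "(\<Union>k. val C k ` gens C k) \<subseteq> (\<Union>k\<in>{0..int n}. val C k ` gens C k)"
    using n by blast
  then show ?thesis by (rule finite_subset) (simp add: finite_gens)
qed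

lemma finite_gap_below:
  fixes A :: "real set"
  assumes "finite A"
  obtains a where "a < x" "\<And>v. v \<in> A \<Longrightarrow> v < x \<Longrightarrow> v \<le> a"
proof
  \<comment> \<open>\<open>x - 1\<close> ensures that the set is nonempty\<close>
  let ?B = "insert (x - 1) {v \<in> A. v < x}"
  show "Max ?B < x" using assms by (subst Max_less_iff) auto
  show "v \<le> Max ?B" if "v \<in> A" "v < x" for v using assms that by (intro Max_ge) auto
qed

text \<open>The points \<open>q\<^sub>1\<close> and \<open>q\<^sub>2\<close> arise from \<open>p\<close> by decreasing one coordinate so slightly that no
  corresponding coordinate of a point of \<open>V\<close> lies strictly in between: a point of \<open>V\<close> strictly below
  \<open>p\<close> is smaller than \<open>p\<close> in one of the coordinates.\<close>

lemma strict_lower_set_two_quadrants: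
  fixes V :: "(real \<times> real) set" and p :: "real \<times> real"
  assumes "finite V"
  obtains q1 q2 where "q1 \<le> p" "q2 \<le> p" "\<And>v. v \<in> V \<Longrightarrow> v < p \<longleftrightarrow> v \<le> q1 \<or> v \<le> q2"
proof -
  obtain a where a: "a < fst p" "\<And>s. s \<in> fst ` V \<Longrightarrow> s < fst p \<Longrightarrow> s \<le> a"
    using finite_gap_below[of "fst ` V"] assms by blast
  obtain b where b: "b < snd p" "\<And>s. s \<in> snd ` V \<Longrightarrow> s < snd p \<Longrightarrow> s \<le> b"
    using finite_gap_below[of "snd ` V"] assms by blast
  show thesis
  proof
    show "(a, snd p) \<le> p" "(fst p, b) \<le> p" using a(1) b(1) by (simp_all add: less_eq_prod_def)
    fix v assume v: "v \<in> V"
    show "v < p \<longleftrightarrow> v \<le> (a, snd p) \<or> v \<le> (fst p, b)"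
      using a(1) a(2)[of "fst v"] b(1) b(2)[of "snd v"] v
      by (auto simp: less_prod_def less_eq_prod_def)
  qed
qed

lemma quasi_isomorphismD:
  assumes "quasi_isomorphism C D f"
  shows "linear_map class_ring (chain_space (gens_in C {..p} k)) (chain_space (gens_in D {..p} k)) (f p k)"
    and "c \<in> chains (gens_in C {..p} k) \<Longrightarrow> f p (k - 1) (bd C k c) = bd D k (f p k c)"
    and "p \<le> q \<Longrightarrow> c \<in> chains (gens_in C {..p} k) \<Longrightarrow> f q k c = f p k c"
    and "bij_betw (homology_map (\<lambda>k. chain_space (gens_in D {..p} k)) (bd D) (f p) k)
      (carrier (homology (\<lambda>k. chain_space (gens_in C {..p} k)) (bd C) k))
      (carrier (homology (\<lambda>k. chain_space (gens_in D {..p} k)) (bd D) k))"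
  using assms unfolding quasi_isomorphism_def upto_eq by (simp_all del: split_paired_All)

text \<open>For \<open>P = {..<p}\<close> this is the chain map on \<open>C\<^sup><\<^sup>p\<close>: since \<open>f\<close> commutes with the inclusions, the image
  of a generator under \<open>f p\<close> is its image under \<open>f v\<close> for its own value \<open>v\<close>, and so has value at most
  \<open>v\<close>.\<close>

lemma quasi_isomorphism_chain_map:
  fixes C :: "('g, 'f::field) bifiltered_complex" and D :: "('h, 'f) bifiltered_complex"
  assumes C: "bifiltered_chain_complex C" and D: "bifiltered_chain_complex D"
    and qi: "quasi_isomorphism C D f" and P: "down_closed P" "P \<subseteq> {..p}"
  shows "chain_map (gens_in C P) (bd C) (gens_in D P) (bd D) (f p)"
proof (intro chain_map.intro chain_map_axioms.intro)
  interpret C: bifiltered_chain_complex C by fact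
  interpret D: bifiltered_chain_complex D by fact
  show "free_complex (gens_in C P) (bd C)" "free_complex (gens_in D P) (bd D)"
    by (rule C.free_complex_gens_in[OF P(1)] D.free_complex_gens_in[OF P(1)])+
  note lin = quasi_isomorphismD(1)[OF qi]
  have sub: "gens_in C P k \<subseteq> gens_in C {..p} k" "gens_in D P k \<subseteq> gens_in D {..p} k" for k
    by (rule gens_in_mono[OF P(2)])+
  fix k
  show "linear_map class_ring (chain_space (gens_in C P k)) (chain_space (gens_in D P k)) (f p k)"
  proof (rule linear_map_chains_restrict[OF lin _ sub])
    show "finite (gens_in C P k)" using C.finite_gens by (simp add: gens_in_def)
    fix g assume g: "g \<in> gens_in C P k"
    let ?v = "val C k g"
    have v: "?v \<in> P" "?v \<le> p" using g P(2) by (auto simp: gens_in_def)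
    have c: "gen_chain g \<in> chains (gens_in C {..?v} k)"
      using g by (simp add: chains_iff gen_chain_def gens_in_def)
    have "f p k (gen_chain g) = f ?v k (gen_chain g)"
      by (rule quasi_isomorphismD(3)[OF qi v(2) c])
    also have "\<dots> \<in> chains (gens_in D {..?v} k)" by (rule linear_map_chains(1)[OF lin c])
    also have "\<dots> \<subseteq> chains (gens_in D P k)"
    proof (rule chains_mono)
      have "{..?v} \<subseteq> P" using P(1) v(1) unfolding down_closed_def by blast
      then show "gens_in D {..?v} k \<subseteq> gens_in D P k" by (rule gens_in_mono)
    qed
    finally show "f p k (gen_chain g) \<in> chains (gens_in D P k)" .
  qed
  fix c :: "'g \<Rightarrow> 'f" assume "c \<in> chains (gens_in C P k)"
  then have "c \<in> chains (gens_in C {..p} k)" using chains_mono[OF sub(1)] by blast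
  then show "f p (k - 1) (bd C k c) = bd D k (f p k c)"
    by (rule quasi_isomorphismD(2)[OF qi])
qed

lemma quasi_isomorphism_cone_exact_upto:
  fixes C :: "('g, 'f::field) bifiltered_complex" and D :: "('h, 'f) bifiltered_complex"
  assumes C: "bifiltered_chain_complex C" and D: "bifiltered_chain_complex D"
    and qi: "quasi_isomorphism C D f" and "q \<le> p"
  shows "cone_exact (gens_in C {..q}) (bd C) (gens_in D {..q}) (bd D) (f p) k"
proof -
  interpret chain_map "gens_in C {..q}" "bd C" "gens_in D {..q}" "bd D" "f q"
    by (rule quasi_isomorphism_chain_map[OF C D qi down_closed_atMost order_refl])
  note bij = quasi_isomorphismD(4)[OF qi, of q]
  have "cone_exact (gens_in C {..q}) (bd C) (gens_in D {..q}) (bd D) (f q) k"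
    by (rule cone_exactI[OF bij_betw_imp_inj_on[OF bij] equalityD2[OF bij_betw_imp_surj_on[OF bij]]])
  then show ?thesis
    by (rule cone_exact_cong) (rule quasi_isomorphismD(3)[OF qi \<open>q \<le> p\<close>])
qed

lemma quasi_isomorphism_cone_exact_below:
  fixes C :: "('g, 'f::field) bifiltered_complex" and D :: "('h, 'f) bifiltered_complex"
  assumes C: "bifiltered_chain_complex C" and D: "bifiltered_chain_complex D"
    and qi: "quasi_isomorphism C D f"
  shows "cone_exact (gens_in C {..<p}) (bd C) (gens_in D {..<p}) (bd D) (f p) k"
proof -
  let ?V = "(\<Union>k. val C k ` gens C k) \<union> (\<Union>k. val D k ` gens D k)"
  have "finite ?V" by (intro finite_UnI bifiltered_chain_complex.finite_vals C D)
  then obtain q1 q2 where q: "q1 \<le> p" "q2 \<le> p"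
    and V: "\<And>v. v \<in> ?V \<Longrightarrow> v < p \<longleftrightarrow> v \<le> q1 \<or> v \<le> q2"
    by (rule strict_lower_set_two_quadrants[where p = p]) blast
  have VC: "val C k g < p \<longleftrightarrow> val C k g \<le> q1 \<or> val C k g \<le> q2" if "g \<in> gens C k" for k g
    by (rule V) (use that in blast)
  have VD: "val D k g < p \<longleftrightarrow> val D k g \<le> q1 \<or> val D k g \<le> q2" if "g \<in> gens D k" for k g
    by (rule V) (use that in blast)
  have un: "gens_in C {..<p} = (\<lambda>k. gens_in C {..q1} k \<union> gens_in C {..q2} k)"
    "gens_in D {..<p} = (\<lambda>k. gens_in D {..q1} k \<union> gens_in D {..q2} k)"
    by (auto simp: gens_in_def fun_eq_iff VC VD)
  have int: "(\<lambda>k. gens_in E {..q1} k \<inter> gens_in E {..q2} k) = gens_in E {..inf q1 q2}"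
    for E :: "('x, 'f) bifiltered_complex"
    by (auto simp: gens_in_def fun_eq_iff)
  note cm = quasi_isomorphism_chain_map[OF C D qi]
  note ex = quasi_isomorphism_cone_exact_upto[OF C D qi]
  show ?thesis
    unfolding un
  proof (rule cone_exact_union)
    show "chain_map (\<lambda>k. gens_in C {..q1} k \<union> gens_in C {..q2} k) (bd C)
        (\<lambda>k. gens_in D {..q1} k \<union> gens_in D {..q2} k) (bd D) (f p)"
      unfolding un[symmetric] by (rule cm[OF down_closed_lessThan]) auto
    show "chain_map (gens_in C {..q1}) (bd C) (gens_in D {..q1}) (bd D) (f p)"
      "chain_map (gens_in C {..q2}) (bd C) (gens_in D {..q2}) (bd D) (f p)"
      by (rule cm[OF down_closed_atMost], use q in simp)+
    show "cone_exact (gens_in C {..q1}) (bd C) (gens_in D {..q1}) (bd D) (f p) k"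
      "cone_exact (gens_in C {..q2}) (bd C) (gens_in D {..q2}) (bd D) (f p) k"
      by (rule ex[OF q(1)], rule ex[OF q(2)])
    have "inf q1 q2 \<le> p" using q(1) by (rule le_infI1)
    then show "cone_exact (\<lambda>k. gens_in C {..q1} k \<inter> gens_in C {..q2} k) (bd C)
        (\<lambda>k. gens_in D {..q1} k \<inter> gens_in D {..q2} k) (bd D) (f p) (k - 1)"
      unfolding int by (rule ex)
  qed
qed

lemma (in bifiltered_chain_complex) delta_eq_relative_homology:
  "delta C p k + subdim (complex_pair.rel_boundaries (gens_in C {..<p}) (gens_in C {..p}) (bd C) k) =
    subdim (complex_pair.rel_cycles (gens_in C {..<p}) (gens_in C {..p}) (bd C) k)"
proof -
  interpret complex_pair "gens_in C {..<p}" "gens_in C {..p}" "bd C"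
    by (rule complex_pair_gens_in) (auto simp: down_closed_atMost down_closed_lessThan)
  show ?thesis
    using dim_relative_homology[of k] by (simp add: delta_def eta_def upto_eq below_eq)
qed

theorem theorem7:
  fixes C :: "('g, 'f::field) bifiltered_complex"
    and D :: "('h, 'f) bifiltered_complex"
    and f :: "real \<times> real \<Rightarrow> int \<Rightarrow> ('g \<Rightarrow> 'f) \<Rightarrow> ('h \<Rightarrow> 'f)"
    and p :: "real \<times> real" and k :: int
  assumes "bifiltered_chain_complex C"
    and "bifiltered_chain_complex D"
    and "quasi_isomorphism C D f"
  shows "int (delta C p k) \<le> gamma D p k"
proof -
  interpret C: bifiltered_chain_complex C by fact
  interpret D: bifiltered_chain_complex D by fact
  let ?A = "gens_in C {..<p}" and ?X = "gens_in C {..p}"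
  let ?E = "gens_in D {..<p}" and ?Y = "gens_in D {..p}"
  have "{..<p} \<subseteq> {..p}" by auto
  note pairC = C.complex_pair_gens_in[OF down_closed_lessThan down_closed_atMost this]
    and pairD = D.complex_pair_gens_in[OF down_closed_lessThan down_closed_atMost this]
  have cm: "chain_map ?X (bd C) ?Y (bd D) (f p)"
    by (rule quasi_isomorphism_chain_map[OF assms down_closed_atMost order_refl])
  have "subdim (complex_pair.rel_cycles ?A ?X (bd C) k) + subdim (chains (?E k) :: ('h \<Rightarrow> 'f) set)
      \<le> subdim (complex_pair.rel_boundaries ?A ?X (bd C) k) + subdim (chains (?Y k) :: ('h \<Rightarrow> 'f) set)"
  proof (rule relative_dim_bound[OF pairC pairD chain_map.h_linear[OF cm]])
    fix x assume "x \<in> complex_pair.rel_cycles ?A ?X (bd C) k"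
      and "f p k x \<in> complex_pair.rel_boundaries ?E ?Y (bd D) k"
    then show "x \<in> complex_pair.rel_boundaries ?A ?X (bd C) k"
      by (rule relative_injective[OF pairC pairD cm quasi_isomorphism_cone_exact_below[OF assms]
            quasi_isomorphism_cone_exact_upto[OF assms order_refl]])
  qed
  moreover have "delta C p k + subdim (complex_pair.rel_boundaries ?A ?X (bd C) k) =
      subdim (complex_pair.rel_cycles ?A ?X (bd C) k)"
    by (rule C.delta_eq_relative_homology)
  moreover have "gamma D p k = int (subdim (chains (?Y k) :: ('h \<Rightarrow> 'f) set)) - int (subdim (chains (?E k) :: ('h \<Rightarrow> 'f) set))"
    by (simp add: gamma_def upto_eq below_eq subdim_def chain_subspace_chains)
  ultimately show ?thesis by linarith
qed

end
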